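(* Let $P_1,\dots,P_n$ be discrete probability measures on $\mathbb{R}^d$ and let $\lambda\in\mathbb{R}^n$ be a strictly positive weight vector with $\sum_{i=1}^n\lambda_i=1$. The Discrete Barycenter Problem for $P_1,\dots,P_n$ and $\lambda$ can be solved using the following linear program (called LP (reduced)) in the variables $y_{ijk}$ ($i=1,\dots,n$, $j=1,\dots,|P_i|$, $k\in S_{ij}$) and $z_k$ ($k=1,\dots,|S|$): $$\begin{array}{rll} \min & \sum_{i=1}^n\lambda_i\sum_{j=1}^{|P_i|}\sum_{k\in S_{ij}}\|\mathbf{x}_k-\mathbf{x}_{ij}\|^2\,y_{ijk} & \\ \text{s.t.} & \sum_{j:(i,j)\in S_k} y_{ijk}=z_k, & \forall i=1,\dots,n,\ \forall k=1,\dots,|S|,\\ & \sum_{k\in S_{ij}} y_{ijk}=d_{ij}, & \forall i=1,\dots,n,\ \forall j=1,\dots,|P_i|,\\ & y_{ijk}\ge 0, & \forall i=1,\dots,n,\ \forall j=1,\dots,|P_i|,\ \forall k\in S_{ij}. \end{array}$$ Moreover, any optimal vertex of this linear program corresponds to a sparse barycenter.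
   Context: Discrete measures: each $P_i$ is a probability measure on $\mathbb{R}^d$ with finite support $\mathrm{supp}(P_i)=\{\mathbf{x}_{ij} : j=1,\dots,|P_i|\}$ (distinct points; $|P_i|$ denotes the number of support points), with mass $d_{ij}>0$ at $\mathbf{x}_{ij}$ and $\sum_{j=1}^{|P_i|}d_{ij}=1$. Barycenter: $W_2$ denotes the quadratic Wasserstein distance, $W_2(\mu,\nu)^2=\inf_{\gamma\in\Pi(\mu,\nu)}\int\|x-y\|^2\,d\gamma(x,y)$, where $\Pi(\mu,\nu)$ is the set of measures on $\mathbb{R}^d\times\mathbb{R}^d$ with marginals $\mu,\nu$. A (discrete) barycenter of $P_1,\dots,P_n$ with weights $\lambda$ is a probability measure $\bar P$ on $\mathbb{R}^d$ minimizing $\sum_{i=1}^n\lambda_iW_2(P,P_i)^2$ over all probability measures $P$ on $\mathbb{R}^d$ with finite second moments. The Discrete Barycenter Problem asks, given $P_1,\dots,P_n$ and $\lambda$, for a barycenter. Sparse: a barycenter $\bar P$ is called sparse if $|\mathrm{supp}(\bar P)|\le\left(\sum_{i=1}^n|P_i|\right)-n+1$. Set of weighted means: $S=\{\sum_{i=1}^n\lambda_i\mathbf{x}_{ij_i} : 1\le j_i\le|P_i|\text{ for all }i\}=\{\mathbf{x}_1,\dots,\mathbf{x}_{|S|}\}$ (distinct elements; single-indexed $\mathbf{x}_k$ are elements of $S$, double-indexed $\mathbf{x}_{ij}$ are support points of $P_i$). Index sets: $S_{ij}$ is the set of indices $k$ such that $\mathbf{x}_k=\lambda_i\mathbf{x}_{ij}+\sum_{l\ne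 i}\lambda_l\mathbf{x}_{lj_l}$ for some choice of $\mathbf{x}_{lj_l}\in\mathrm{supp}(P_l)$, $l\neq i$. $S_k$ is the set of pairs $(i,j)$ with $k\in S_{ij}$. Meaning of the statement: "can be solved using the LP" means that the LP has an optimal solution and that for every optimal solution $(y,z)$ the measure $\bar P=\sum_{k=1}^{|S|}z_k\delta_{\mathbf{x}_k}$ is a barycenter. An optimal vertex $(y,z)$ (an optimal solution that is a vertex of the feasible polyhedron) corresponds to the measure $\sum_{k=1}^{|S|}z_k\delta_{\mathbf{x}_k}$. *)

theory Defs
  imports "HOL-Probability.Probability" "HOL-Analysis.Finite_Function_Topology"
begin

definition supp :: "'a::topological_space measure \<Rightarrow> 'a set" where
  "supp M = {p. \<forall>U. open U \<and> p \<in> U \<longrightarrow> emeasure M U > 0}"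

definition prob2 :: "'a::euclidean_space measure set" where
  "prob2 = {M. prob_space M \<and> sets M = sets borel \<and>
     (\<integral>\<^sup>+ p. ennreal ((norm p)\<^sup>2) \<partial>M) < \<infinity>}"

definition couplings ::
    "'a::euclidean_space measure \<Rightarrow> 'a measure \<Rightarrow> ('a \<times> 'a) measure set" where
  "couplings M M' = {G. sets G = sets (borel \<Otimes>\<^sub>M borel) \<and>
     distr G borel fst = M \<and> distr G borel snd = M'}"

text \<open>The square of the quadratic Wasserstein distance, with values in the extended
  nonnegative reals so that no convention for infinite values is needed.\<close>

definition W2_squared ::
    "'a::euclidean_space measure \<Rightarrow> 'a measure \<Rightarrow> ennreal" where
  "W2_squared M M' =
     (INF G\<in>couplings M M'. \<integral>\<^sup>+ q. ennreal ((norm (fst q - snd q))\<^sup>2) \<partial>G)"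

definition barycenter_objective ::
    "nat \<Rightarrow> (nat \<Rightarrow> real) \<Rightarrow> (nat \<Rightarrow> 'a::euclidean_space measure) \<Rightarrow> 'a measure \<Rightarrow> ennreal" where
  "barycenter_objective n lam P M = (\<Sum>i\<in>{1..n}. ennreal (lam i) * W2_squared M (P i))"

definition is_barycenter ::
    "nat \<Rightarrow> (nat \<Rightarrow> real) \<Rightarrow> (nat \<Rightarrow> 'a::euclidean_space measure) \<Rightarrow> 'a measure \<Rightarrow> bool" where
  "is_barycenter n lam P M \<longleftrightarrow> M \<in> prob2 \<and>
     (\<forall>Q\<in>prob2. barycenter_objective n lam P M \<le> barycenter_objective n lam P Q)"

text \<open>Finiteness of the support is stated explicitly because the cardinality of an
  infinite set is 0; the bound is over the integers to avoid truncated subtraction.\<close>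

definition is_sparse_barycenter ::
    "nat \<Rightarrow> (nat \<Rightarrow> real) \<Rightarrow> (nat \<Rightarrow> 'a::euclidean_space measure) \<Rightarrow> 'a measure \<Rightarrow> bool" where
  "is_sparse_barycenter n lam P M \<longleftrightarrow> is_barycenter n lam P M \<and> finite (supp M) \<and>
     int (card (supp M)) \<le> (\<Sum>i\<in>{1..n}. int (card (supp (P i)))) - int n + 1"

text \<open>\<open>M\<close> is a Borel probability measure whose support consists of the \<open>N\<close> distinct
  points \<open>x 1, \<dots>, x N\<close>, with mass \<open>d j\<close> at \<open>x j\<close>.\<close>

definition discrete_prob ::
    "'a::euclidean_space measure \<Rightarrow> nat \<Rightarrow> (nat \<Rightarrow> 'a) \<Rightarrow> (nat \<Rightarrow> real) \<Rightarrow> bool" where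
  "discrete_prob M N x d \<longleftrightarrow> prob_space M \<and> sets M = sets borel \<and>
     bij_betw x {1..N} (supp M) \<and>
     (\<forall>j\<in>{1..N}. d j > 0 \<and> measure M {x j} = d j) \<and> (\<Sum>j\<in>{1..N}. d j) = 1"

text \<open>The Borel measure \<open>\<Sum>k\<in>K. w k \<cdot> \<delta>\<^bsub>X k\<^esub>\<close> for nonnegative weights \<open>w\<close>, as the
  image under \<open>X\<close> of the measure with point masses \<open>w\<close> on the index set \<open>K\<close>.\<close>

definition dirac_sum :: "nat set \<Rightarrow> (nat \<Rightarrow> real) \<Rightarrow> (nat \<Rightarrow> 'a::euclidean_space) \<Rightarrow> 'a measure" where
  "dirac_sum K w X = distr (point_measure K (\<lambda>k. ennreal (w k))) borel X"

text \<open>\<open>x i j\<close> is the \<open>j\<close>-th of the \<open>N i\<close> support points of the \<open>i\<close>-th measure, with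
  mass \<open>d i j\<close>, and \<open>X 1, X 2, \<dots>\<close> enumerates the set of weighted means.\<close>

context
  fixes n :: nat
    and lam :: "nat \<Rightarrow> real"
    and N :: "nat \<Rightarrow> nat"
    and x :: "nat \<Rightarrow> nat \<Rightarrow> 'a::euclidean_space"
    and d :: "nat \<Rightarrow> nat \<Rightarrow> real"
    and X :: "nat \<Rightarrow> 'a"
begin

definition weighted_means :: "'a set" where
  "weighted_means =
     {(\<Sum>i\<in>{1..n}. lam i *\<^sub>R x i (J i)) | J. \<forall>i\<in>{1..n}. J i \<in> {1..N i}}"

definition S_pair :: "nat \<Rightarrow> nat \<Rightarrow> nat set" where
  "S_pair i j = {k \<in> {1..card weighted_means}.
     \<exists>J. (\<forall>l\<in>{1..n} - {i}. J l \<in> {1..N l}) \<and>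
         X k = lam i *\<^sub>R x i j + (\<Sum>l\<in>{1..n} - {i}. lam l *\<^sub>R x l (J l))}"

definition S_single :: "nat \<Rightarrow> (nat \<times> nat) set" where
  "S_single k = {(i, j). i \<in> {1..n} \<and> j \<in> {1..N i} \<and> k \<in> S_pair i j}"

text \<open>A point of the LP is a pair \<open>(y, z)\<close> of finitely supported functions. The
  conditions on \<^const>\<open>Poly_Mapping.keys\<close> pin every coordinate that is not a variable
  of the LP to 0, so that the feasible set lies in the coordinate subspace spanned by the
  LP variables and its extreme points are the vertices of the feasible polyhedron.\<close>

definition lp_feasible :: "((nat \<times> nat \<times> nat \<Rightarrow>\<^sub>0 real) \<times> (nat \<Rightarrow>\<^sub>0 real)) set" where
  "lp_feasible = {(y, z).
     Poly_Mapping.keys y \<subseteq> {(i, j, k). i \<in> {1..n} \<and> j \<in> {1..N i} \<and> k \<in> S_pair i j} \<and>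
     Poly_Mapping.keys z \<subseteq> {1..card weighted_means} \<and>
     (\<forall>i\<in>{1..n}. \<forall>k\<in>{1..card weighted_means}.
        (\<Sum>j\<in>{j. (i, j) \<in> S_single k}. Poly_Mapping.lookup y (i, j, k)) = Poly_Mapping.lookup z k) \<and>
     (\<forall>i\<in>{1..n}. \<forall>j\<in>{1..N i}. (\<Sum>k\<in>S_pair i j. Poly_Mapping.lookup y (i, j, k)) = d i j) \<and>
     (\<forall>i\<in>{1..n}. \<forall>j\<in>{1..N i}. \<forall>k\<in>S_pair i j. Poly_Mapping.lookup y (i, j, k) \<ge> 0)}"

definition lp_cost :: "(nat \<times> nat \<times> nat \<Rightarrow>\<^sub>0 real) \<Rightarrow> real" where
  "lp_cost y = (\<Sum>i\<in>{1..n}. lam i * (\<Sum>j\<in>{1..N i}. \<Sum>k\<in>S_pair i j.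
     (norm (X k - x i j))\<^sup>2 * Poly_Mapping.lookup y (i, j, k)))"

definition lp_optimal :: "((nat \<times> nat \<times> nat \<Rightarrow>\<^sub>0 real) \<times> (nat \<Rightarrow>\<^sub>0 real)) set" where
  "lp_optimal = {(y, z) \<in> lp_feasible. \<forall>(y', z') \<in> lp_feasible. lp_cost y \<le> lp_cost y'}"

end

end

theory Submission
  imports Defs
begin

text \<open>
  A choice function \<open>J\<close> selects one support point \<open>x i (J i)\<close> of each measure. A weighting of the choice
  functions whose marginals are the given measures yields a feasible point of the LP by collecting
  the weight of \<open>J\<close> at the weighted mean of the selected points. Conversely, for an arbitrary
  probability measure \<open>Q\<close> and couplings of \<open>Q\<close> with the given measures, integrating the product of
  the conditional probabilities given the \<open>Q\<close>-coordinate (a gluing of the couplings along \<open>Q\<close>) gives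
  such a weighting. Since the weighted mean minimizes the weighted sum of squared distances, the
  resulting LP cost is at most the transport cost of the couplings; a feasible point of the LP, in
  turn, is a family of couplings of \<open>\<Sum>k. z k \<cdot> \<delta>\<^bsub>X k\<^esub>\<close> with the given measures. So both optimal values agree.

  For sparsity, pick for every \<open>k\<close> with \<open>z k > 0\<close> and every \<open>i\<close> some \<open>j = J k i\<close> with \<open>y (i, j, k) > 0\<close>.
  Changing \<open>z k\<close> and all \<open>y (i, J k i, k)\<close> by \<open>t k\<close> keeps the equations of the LP if \<open>t\<close> satisfies
  \<open>1 + (\<Sum>i. N i - 1)\<close> homogeneous linear equations, so at an extreme point there are at most that
  many such \<open>k\<close>.
\<close>

subsection \<open>Preliminaries\<close>

lemma sum_mult_of_bool:
  assumes "finite A" "a \<in> A"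
  shows "(\<Sum>j\<in>A. f j * of_bool (a = j)) = (f a :: 'b::semiring_1)"
  using assms by (simp add: of_bool_def if_distrib cong: if_cong)

lemma exists_poly_mapping:
  fixes f :: "'k \<Rightarrow> 'b::zero"
  assumes "finite V"
  shows "\<exists>p. \<forall>v. Poly_Mapping.lookup p v = (if v \<in> V then f v else 0)"
proof (intro exI allI)
  fix v
  show "Poly_Mapping.lookup (Abs_poly_mapping (\<lambda>v. if v \<in> V then f v else 0)) v =
      (if v \<in> V then f v else 0)"
    using assms by (subst lookup_Abs_poly_mapping) auto
qed

lemma lookup_scaleR_poly_mapping:
  "Poly_Mapping.lookup (r *\<^sub>R p) v = r *\<^sub>R Poly_Mapping.lookup p v"
proof -
  have "finite {i. r *\<^sub>R Poly_Mapping.lookup p i \<noteq> 0}"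
    by (rule finite_subset[OF _ finite_keys[of p]]) (auto simp: in_keys_iff)
  then show ?thesis
    by (simp add: scaleR_poly_mapping_def)
qed

text \<open>The two sides differ by exactly the squared distance from \<open>p\<close> to the
  weighted mean, as expanding the squares around the mean shows.\<close>

lemma sum_sq_dist_weighted_mean_le:
  fixes a :: "'i \<Rightarrow> 'a::real_inner"
  assumes "(\<Sum>i\<in>I. c i) = 1"
  shows "(\<Sum>i\<in>I. c i * (norm ((\<Sum>i\<in>I. c i *\<^sub>R a i) - a i))\<^sup>2) \<le> (\<Sum>i\<in>I. c i * (norm (p - a i))\<^sup>2)"
proof -
  define m where "m = (\<Sum>i\<in>I. c i *\<^sub>R a i)"
  \<comment> \<open>The last term is kept linear in the weighted point \<open>a i\<close>, so that
    summation over \<open>I\<close> turns it into an inner product with \<open>m\<close>.\<close>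
  have "c i * (norm (p - a i))\<^sup>2 =
      c i * (norm (m - a i))\<^sup>2 + c i * ((norm p)\<^sup>2 - (norm m)\<^sup>2) - 2 * (inner (p - m) (c i *\<^sub>R a i))" for i
    by (simp add: power2_norm_eq_inner inner_diff_left inner_diff_right inner_commute algebra_simps)
  then have "(\<Sum>i\<in>I. c i * (norm (p - a i))\<^sup>2) =
      (\<Sum>i\<in>I. c i * (norm (m - a i))\<^sup>2) + ((norm p)\<^sup>2 - (norm m)\<^sup>2) - 2 * inner (p - m) m"
    using assms
    by (simp add: sum.distrib sum_subtractf inner_sum_right m_def flip: sum_distrib_right sum_distrib_left)
  moreover have "((norm p)\<^sup>2 - (norm m)\<^sup>2) - 2 * inner (p - m) m = (norm (p - m))\<^sup>2"
    by (simp add: power2_norm_eq_inner inner_diff_left inner_diff_right inner_commute algebra_simps)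
  ultimately show ?thesis
    unfolding m_def by (smt (verit) zero_le_power2)
qed

text \<open>Gaussian elimination by induction on the equations: an unknown with nonzero coefficient
  in the new equation serves as pivot and is removed together with that equation.\<close>

lemma homogeneous_system_nontrivial_solution:
  fixes a :: "'e \<Rightarrow> 'k \<Rightarrow> 'b::field"
  assumes "finite E" "finite A" "card E < card A"
  shows "\<exists>t. (\<exists>k\<in>A. t k \<noteq> 0) \<and> (\<forall>e\<in>E. (\<Sum>k\<in>A. t k * a e k) = 0)"
  using assms
proof (induction E arbitrary: A a rule: finite_induct)
  case empty
  then show ?case by (intro exI[of _ "\<lambda>_. 1"]) (auto simp: card_gt_0_iff)
next
  case (insert e E)
  show ?case
  proof (cases "\<forall>k\<in>A. a e k = 0")
    case True
    with insert.IH[of A a] insert.prems insert.hyps show ?thesis by auto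
  next
    case False
    then obtain p where p: "p \<in> A" "a e p \<noteq> 0" by blast
    \<comment> \<open>Row \<open>e'\<close> minus the multiple of row \<open>e\<close> that clears
      column \<open>p\<close>.\<close>
    define b where "b e' k = a e' k - a e' p * a e k / a e p" for e' k
    have "card E < card (A - {p})"
      using insert.prems insert.hyps p by simp
    then obtain t where t: "\<exists>k\<in>A - {p}. t k \<noteq> 0" "\<And>e'. e' \<in> E \<Longrightarrow> (\<Sum>k\<in>A - {p}. t k * b e' k) = 0"
      using insert.IH[of "A - {p}" b] insert.prems by auto
    define s where "s = (\<Sum>k\<in>A - {p}. t k * a e k)"
    \<comment> \<open>The value at the pivot is forced by equation \<open>e\<close>.\<close>
    define u where "u = t(p := - s / a e p)"
    have u: "(\<Sum>k\<in>A. u k * a e' k) = - s / a e p * a e' p + (\<Sum>k\<in>A - {p}. t k * a e' k)" for e'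
      using p insert.prems by (subst sum.remove[of _ p]) (auto simp: u_def intro!: sum.cong)
    have "(\<Sum>k\<in>A. u k * a e k) = 0"
      using p by (simp add: u s_def)
    moreover have "(\<Sum>k\<in>A. u k * a e' k) = 0" if "e' \<in> E" for e'
    proof -
      have "0 = (\<Sum>k\<in>A - {p}. t k * a e' k - (t k * a e k) * (a e' p / a e p))"
        unfolding t(2)[OF that, symmetric] b_def
        by (intro sum.cong refl) (simp add: algebra_simps)
      also have "\<dots> = (\<Sum>k\<in>A - {p}. t k * a e' k) - s * (a e' p / a e p)"
        by (simp only: sum_subtractf s_def sum_distrib_right)
      finally show ?thesis by (simp add: u)
    qed
    ultimately show ?thesis
      using t(1) by (intro exI[of _ u]) (auto simp: u_def)
  qed
qed

text \<open>The midpoint criterion used against extremality: a point that can be moved by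
  \<open>h\<close> in both directions within a set is not extreme in it.\<close>

lemma pair_in_open_segment:
  fixes v h :: "'v::real_vector"
  assumes "h \<noteq> 0"
  shows "v \<in> open_segment (v - h) (v + h)"
  unfolding in_segment
proof (intro conjI exI[of _ "1/2"])
  show "v - h \<noteq> v + h"
  proof
    assume "v - h = v + h"
    then have "2 *\<^sub>R h = 0" by (simp add: scaleR_2 algebra_simps)
    with assms show False by simp
  qed
  show "v = (1 - 1 / 2) *\<^sub>R (v - h) + (1 / 2) *\<^sub>R (v + h)"
    by (simp add: algebra_simps flip: scaleR_add_left)
qed auto

subsection \<open>Discrete measures and couplings\<close>

lemma nn_integral_distr_point_measure:
  assumes "finite V" "g \<in> V \<rightarrow> space M" "h \<in> borel_measurable M"
  shows "(\<integral>\<^sup>+ p. h p \<partial>distr (point_measure V w) M g) = (\<Sum>v\<in>V. w v * h (g v))"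
  using assms by (subst nn_integral_distr) (auto simp: nn_integral_point_measure_finite)

lemma emeasure_distr_point_measure:
  assumes "finite V" "g \<in> V \<rightarrow> space M" "A \<in> sets M"
  shows "emeasure (distr (point_measure V w) M g) A = (\<Sum>v\<in>V. w v * indicator A (g v))"
  using nn_integral_distr_point_measure[OF assms(1,2), of "indicator A" w] assms(3)
  by (simp add: nn_integral_indicator)

lemma discrete_prob_inj_on: "discrete_prob M N x d \<Longrightarrow> inj_on x {1..N}"
  by (auto simp: discrete_prob_def bij_betw_def)

lemma discrete_prob_emeasure_singleton:
  assumes "discrete_prob M N x d" "j \<in> {1..N}"
  shows "emeasure M {x j} = ennreal (d j)"
proof -
  interpret prob_space M using assms by (simp add: discrete_prob_def)
  show ?thesis using assms by (simp add: emeasure_eq_measure discrete_prob_def)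
qed

text \<open>The masses of the distinct points \<open>x j\<close> already add up to 1, so their
  complement is a null set.\<close>

lemma AE_discrete_prob:
  assumes M: "discrete_prob M N x d"
  shows "AE p in M. p \<in> x ` {1..N}"
proof -
  interpret prob_space M using M by (simp add: discrete_prob_def)
  have sets: "sets M = sets borel" using M by (simp add: discrete_prob_def)
  have "measure M (x ` {1..N}) = (\<Sum>p\<in>x ` {1..N}. measure M {p})"
    using sets by (intro finite_measure_eq_sum_singleton) auto
  also have "\<dots> = (\<Sum>j\<in>{1..N}. measure M {x j})"
    by (rule sum.reindex_cong[OF discrete_prob_inj_on[OF M]]) auto
  also have "\<dots> = 1"
    using M by (simp add: discrete_prob_def)
  finally show ?thesis by (rule AE_prob_1)
qed

text \<open>Up to a null set, a Borel set consists of the points \<open>x j\<close> in it, and the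
  mass of these distinct points is additive. The explicit form makes the marginals of an LP
  transport plan computable.\<close>

lemma discrete_prob_eq_dirac_sum:
  assumes M: "discrete_prob M N x d"
  shows "M = dirac_sum {1..N} d x"
proof (rule measure_eqI)
  have sets: "sets M = sets borel" using M by (simp add: discrete_prob_def)
  then show "sets M = sets (dirac_sum {1..N} d x)" by (simp add: dirac_sum_def)
  fix A assume "A \<in> sets M"
  then have A: "A \<in> sets borel" by (simp add: sets)
  have "x ` {1..N} \<in> sets borel"
    by (intro borel_closed finite_imp_closed) simp
  with A have A_meas: "A \<in> sets M" "A \<inter> x ` {1..N} \<in> sets M"
    unfolding sets by (auto intro: sets.Int)
  have "emeasure M A = emeasure M (A \<inter> x ` {1..N})"
  proof (rule emeasure_eq_AE)
    show "AE p in M. p \<in> A \<longleftrightarrow> p \<in> A \<inter> x ` {1..N}"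
      using AE_discrete_prob[OF M] by eventually_elim blast
  qed (fact A_meas)+
  also have "\<dots> = (\<Sum>j\<in>{1..N}. emeasure M (A \<inter> x ` {1..N} \<inter> {x j}))"
  proof (rule sum_emeasure_cover)
    show "disjoint_family_on (\<lambda>j. {x j}) {1..N}"
      using discrete_prob_inj_on[OF M] by (simp add: disjoint_family_on_def inj_on_eq_iff)
    show "A \<inter> x ` {1..N} \<in> sets M" by (fact A_meas)
  qed (auto simp: sets)
  also have "\<dots> = (\<Sum>j\<in>{1..N}. ennreal (d j) * indicator A (x j))"
  proof (intro sum.cong refl)
    fix j assume j: "j \<in> {1..N}"
    then have "A \<inter> x ` {1..N} \<inter> {x j} = (if x j \<in> A then {x j} else {})" by auto
    then show "emeasure M (A \<inter> x ` {1..N} \<inter> {x j}) = ennreal (d j) * indicator A (x j)"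
      using discrete_prob_emeasure_singleton[OF M j] by simp
  qed
  also have "\<dots> = emeasure (dirac_sum {1..N} d x) A"
    unfolding dirac_sum_def using A by (subst emeasure_distr_point_measure) auto
  finally show "emeasure M A = emeasure (dirac_sum {1..N} d x) A" .
qed

text \<open>The density \<open>g j\<close> is the conditional probability, given the first coordinate, that the
  second one is \<open>x j\<close>; it replaces a disintegration of the coupling.\<close>

lemma coupling_densities:
  fixes Q :: "'a::euclidean_space measure"
  assumes Q: "prob_space Q" "sets Q = sets borel"
    and P: "discrete_prob P N x d"
    and G: "G \<in> couplings Q P"
  obtains g where "\<And>j. j \<in> {1..N} \<Longrightarrow> g j \<in> borel_measurable borel"
    and "AE p in Q. (\<Sum>j\<in>{1..N}. g j p) = 1"
    and "\<And>j. j \<in> {1..N} \<Longrightarrow> (\<integral>\<^sup>+ p. g j p \<partial>Q) = ennreal (d j)"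
    and "(\<integral>\<^sup>+ q. ennreal ((norm (fst q - snd q))\<^sup>2) \<partial>G) =
      (\<Sum>j\<in>{1..N}. \<integral>\<^sup>+ p. ennreal ((norm (p - x j))\<^sup>2) * g j p \<partial>Q)"
proof -
  interpret Q: prob_space Q by fact
  have sets_G [measurable_cong]: "sets G = sets (borel \<Otimes>\<^sub>M borel)"
    and fst_G: "distr G borel fst = Q" and snd_G: "distr G borel snd = P"
    using G by (auto simp: couplings_def)
  note sets_Q [measurable_cong] = Q(2)
  \<comment> \<open>\<open>\<nu> j\<close> is the first marginal of the part of \<open>G\<close>
    that is transported to \<open>x j\<close>; the desired \<open>g j\<close> is its density with
    respect to \<open>Q\<close>.\<close>
  define \<nu> where "\<nu> j = distr (density G (\<lambda>q. indicator {x j} (snd q))) borel fst" for j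
  have "\<exists>g\<in>borel_measurable Q. density Q g = \<nu> j" for j
  proof (rule Q.Radon_Nikodym)
    \<comment> \<open>The first marginal of \<open>G\<close> is \<open>Q\<close>, so the preimage
      under \<open>fst\<close> of a \<open>Q\<close>-null set is \<open>G\<close>-null, and this
      remains true on the part of \<open>G\<close> over \<open>x j\<close>.\<close>
    show "absolutely_continuous Q (\<nu> j)"
      unfolding absolutely_continuous_def
    proof
      fix A assume A: "A \<in> null_sets Q"
      then have A_sets: "A \<in> sets borel" by (auto simp: Q(2))
      have "AE p in Q. p \<notin> A" using A by (rule AE_not_in)
      then have "AE q in G. fst q \<notin> A"
        unfolding fst_G[symmetric] by (rule AE_distrD[rotated]) simp
      then have "(\<integral>\<^sup>+ q. indicator {x j} (snd q) * indicator (fst -` A \<inter> space G) q \<partial>G) = (\<integral>\<^sup>+ q. 0 \<partial>G)"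
        by (intro nn_integral_cong_AE) (auto split: split_indicator)
      then have "emeasure (\<nu> j) A = 0"
        unfolding \<nu>_def using A_sets by (simp add: emeasure_distr emeasure_density)
      with A_sets show "A \<in> null_sets (\<nu> j)"
        by (auto simp: null_sets_def \<nu>_def)
    qed
  qed (simp add: \<nu>_def Q(2))
  then obtain g where g_meas: "\<And>j. g j \<in> borel_measurable Q" and g: "\<And>j. density Q (g j) = \<nu> j"
    by metis
  have g_borel [measurable]: "g j \<in> borel_measurable borel" for j
    using g_meas[of j] by (simp cong: measurable_cong_sets add: Q(2))
  have integral_g: "(\<integral>\<^sup>+ p. h p * g j p \<partial>Q) = (\<integral>\<^sup>+ q. indicator {x j} (snd q) * h (fst q) \<partial>G)"
    if [measurable]: "h \<in> borel_measurable borel" for h j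
  proof -
    have "(\<integral>\<^sup>+ p. h p * g j p \<partial>Q) = (\<integral>\<^sup>+ p. h p \<partial>density Q (g j))"
      by (subst nn_integral_density) (auto simp: mult.commute)
    also have "\<dots> = (\<integral>\<^sup>+ q. indicator {x j} (snd q) * h (fst q) \<partial>G)"
      unfolding g \<nu>_def by (subst nn_integral_distr, simp, simp, subst nn_integral_density) auto
    finally show ?thesis .
  qed
  have AE_G: "AE q in G. snd q \<in> x ` {1..N}"
    using AE_discrete_prob[OF P] unfolding snd_G[symmetric] by (rule AE_distrD[rotated]) simp
  \<comment> \<open>The disintegration formula: an integral over \<open>G\<close> splits according
    to the second coordinate. Almost everywhere exactly one indicator is 1, because \<open>x\<close>
    is injective on the indices.\<close>
  have sum_integral_g: "(\<Sum>j\<in>{1..N}. \<integral>\<^sup>+ p. H (p, x j) * g j p \<partial>Q) = (\<integral>\<^sup>+ q. H q \<partial>G)"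
    if H [measurable]: "H \<in> borel_measurable (borel \<Otimes>\<^sub>M borel)" for H
  proof -
    have "(\<Sum>j\<in>{1..N}. \<integral>\<^sup>+ p. H (p, x j) * g j p \<partial>Q) =
        (\<integral>\<^sup>+ q. (\<Sum>j\<in>{1..N}. indicator {x j} (snd q) * H (fst q, x j)) \<partial>G)"
      by (subst nn_integral_sum) (auto intro!: sum.cong integral_g)
    also have "\<dots> = (\<integral>\<^sup>+ q. H q \<partial>G)"
    proof (rule nn_integral_cong_AE)
      show "AE q in G. (\<Sum>j\<in>{1..N}. indicator {x j} (snd q) * H (fst q, x j)) = H q"
        using AE_G
      proof eventually_elim
        case (elim q)
        then obtain m where m: "m \<in> {1..N}" "snd q = x m" by blast
        have "(\<Sum>j\<in>{1..N}. indicator {x j} (snd q) * H (fst q, x j)) =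
            (\<Sum>j\<in>{1..N}. if j = m then H (fst q, x m) else 0)"
        proof (intro sum.cong refl)
          fix j assume "j \<in> {1..N}"
          then have "snd q = x j \<longleftrightarrow> j = m"
            using m discrete_prob_inj_on[OF P] by (auto dest: inj_onD)
          then show "indicator {x j} (snd q) * H (fst q, x j) = (if j = m then H (fst q, x m) else 0)"
            by auto
        qed
        also have "\<dots> = H q"
          using m(1) by (simp add: m(2)[symmetric])
        finally show ?case .
      qed
    qed
    finally show ?thesis .
  qed
  show thesis
  proof (rule that)
    show "g j \<in> borel_measurable borel" for j by simp
    \<comment> \<open>With \<open>H\<close> depending on the first coordinate only, the formula says
      that the densities add up to that of the first marginal \<open>Q\<close> itself, which is
      1.\<close>
    have "density Q (\<lambda>p. \<Sum>j\<in>{1..N}. g j p) = density Q (\<lambda>_. 1)"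
    proof (rule measure_eqI)
      fix A assume "A \<in> sets (density Q (\<lambda>p. \<Sum>j\<in>{1..N}. g j p))"
      then have A [measurable]: "A \<in> sets borel" by (simp add: Q(2))
      then have A_Q: "A \<in> sets Q" by (simp add: Q(2))
      have "emeasure (density Q (\<lambda>p. \<Sum>j\<in>{1..N}. g j p)) A =
          (\<integral>\<^sup>+ p. (\<Sum>j\<in>{1..N}. indicator A p * g j p) \<partial>Q)"
        using A_Q by (subst emeasure_density) (auto simp: sum_distrib_left mult.commute)
      also have "\<dots> = (\<Sum>j\<in>{1..N}. \<integral>\<^sup>+ p. indicator A (fst (p, x j)) * g j p \<partial>Q)"
        by (subst nn_integral_sum) auto
      also have "\<dots> = (\<integral>\<^sup>+ q. indicator A (fst q) \<partial>G)"
        by (rule sum_integral_g) measurable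
      also have "\<dots> = (\<integral>\<^sup>+ p. indicator A p \<partial>Q)"
        unfolding fst_G[symmetric] by (subst nn_integral_distr) auto
      also have "\<dots> = emeasure (density Q (\<lambda>_. 1)) A"
        using A_Q by (simp add: emeasure_density)
      finally show "emeasure (density Q (\<lambda>p. \<Sum>j\<in>{1..N}. g j p)) A = emeasure (density Q (\<lambda>_. 1)) A" .
    qed simp
    then show "AE p in Q. (\<Sum>j\<in>{1..N}. g j p) = 1"
      by (rule Q.density_unique[rotated 2]) auto
    show "(\<integral>\<^sup>+ p. g j p \<partial>Q) = ennreal (d j)" if j: "j \<in> {1..N}" for j
    proof -
      have "(\<integral>\<^sup>+ p. g j p \<partial>Q) = (\<integral>\<^sup>+ q. indicator {x j} (snd q) \<partial>G)"
        using integral_g[of "\<lambda>_. 1" j] by simp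
      also have "\<dots> = (\<integral>\<^sup>+ p. indicator {x j} p \<partial>P)"
        unfolding snd_G[symmetric] by (subst nn_integral_distr) auto
      also have "\<dots> = ennreal (d j)"
        using discrete_prob_emeasure_singleton[OF P j] P by (simp add: discrete_prob_def)
      finally show ?thesis .
    qed
    show "(\<integral>\<^sup>+ q. ennreal ((norm (fst q - snd q))\<^sup>2) \<partial>G) =
        (\<Sum>j\<in>{1..N}. \<integral>\<^sup>+ p. ennreal ((norm (p - x j))\<^sup>2) * g j p \<partial>Q)"
      using sum_integral_g[of "\<lambda>q. ennreal ((norm (fst q - snd q))\<^sup>2)"] by simp
  qed
qed

text \<open>An infimum over couplings is replaced by a coupling whose value is within
  \<open>e\<close> of it, independently for each \<open>i\<close>. Since the weights add up to 1,
  the total excess is exactly \<open>e\<close>.\<close>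

lemma le_sum_INF_ennreal:
  fixes c :: ennreal and a :: "'i \<Rightarrow> real"
  assumes I: "finite I" and a: "\<And>i. i \<in> I \<Longrightarrow> a i > 0" and a_sum: "sum a I = 1"
    and le: "\<And>G. (\<And>i. i \<in> I \<Longrightarrow> G i \<in> A i) \<Longrightarrow> c \<le> (\<Sum>i\<in>I. ennreal (a i) * F i (G i))"
  shows "c \<le> (\<Sum>i\<in>I. ennreal (a i) * (INF g\<in>A i. F i g))"
proof (rule ennreal_le_epsilon)
  fix e :: real
  assume fin: "(\<Sum>i\<in>I. ennreal (a i) * (INF g\<in>A i. F i g)) < top" and e: "e > 0"
  have "\<exists>g\<in>A i. F i g < (INF g\<in>A i. F i g) + ennreal e" if i: "i \<in> I" for i
  proof (rule INF_approx_ennreal[OF e refl])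
    \<comment> \<open>A positive weight would make the whole sum infinite if this infimum were, so
      near-minimizers exist; in particular \<open>A i\<close> is then nonempty.\<close>
    have "ennreal (a i) * (INF g\<in>A i. F i g) < top"
      using fin i I by simp
    then show "(INF g\<in>A i. F i g) \<noteq> \<infinity>"
      using a[OF i] by (metis ennreal_mult_top ennreal_eq_0_iff infinity_ennreal_def less_irrefl not_less)
  qed
  then obtain G where G: "\<And>i. i \<in> I \<Longrightarrow> G i \<in> A i \<and> F i (G i) < (INF g\<in>A i. F i g) + ennreal e"
    by metis
  then have "c \<le> (\<Sum>i\<in>I. ennreal (a i) * F i (G i))"
    by (intro le) blast
  also have "\<dots> \<le> (\<Sum>i\<in>I. ennreal (a i) * ((INF g\<in>A i. F i g) + ennreal e))"
  proof (intro sum_mono mult_left_mono)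
    show "F i (G i) \<le> (INF g\<in>A i. F i g) + ennreal e" if "i \<in> I" for i
      using G[OF that] by (simp add: less_imp_le)
  qed simp
  also have "\<dots> = (\<Sum>i\<in>I. ennreal (a i) * (INF g\<in>A i. F i g)) + (\<Sum>i\<in>I. ennreal (a i)) * ennreal e"
    by (simp add: distrib_left sum.distrib sum_distrib_right)
  also have "(\<Sum>i\<in>I. ennreal (a i)) = 1"
    using a a_sum by (subst sum_ennreal) (auto intro: less_imp_le)
  finally show "c \<le> (\<Sum>i\<in>I. ennreal (a i) * (INF g\<in>A i. F i g)) + ennreal e"
    by simp
qed

subsection \<open>Choice functions and the polyhedron of the LP\<close>

text \<open>Only the numerical data of the LP are fixed here; the measures \<open>P i\<close> enter
  through assumptions of the lemmas on transport.\<close>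

locale barycenter_lp =
  fixes n :: nat
    and lam :: "nat \<Rightarrow> real"
    and N :: "nat \<Rightarrow> nat"
    and x :: "nat \<Rightarrow> nat \<Rightarrow> 'a::euclidean_space"
    and d :: "nat \<Rightarrow> nat \<Rightarrow> real"
    and X :: "nat \<Rightarrow> 'a"
  assumes lam_pos: "i \<in> {1..n} \<Longrightarrow> lam i > 0"
    and lam_sum: "(\<Sum>i\<in>{1..n}. lam i) = 1"
    and d_pos: "i \<in> {1..n} \<Longrightarrow> j \<in> {1..N i} \<Longrightarrow> d i j > 0"
    and d_sum: "i \<in> {1..n} \<Longrightarrow> (\<Sum>j\<in>{1..N i}. d i j) = 1"
    and X_bij: "bij_betw X {1..card (weighted_means n lam N x)} (weighted_means n lam N x)"
begin

abbreviation "K \<equiv> {1..card (weighted_means n lam N x)}"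
abbreviation "S \<equiv> S_pair n lam N x X"
abbreviation "feasible \<equiv> lp_feasible n lam N x d X"
abbreviation "cost \<equiv> lp_cost n lam N x X"

text \<open>Extensional functions, so that there are only finitely many and products of sums expand
  over them.\<close>

definition choices :: "(nat \<Rightarrow> nat) set" where
  "choices = (\<Pi>\<^sub>E i\<in>{1..n}. {1..N i})"

definition mean :: "(nat \<Rightarrow> nat) \<Rightarrow> 'a" where
  "mean J = (\<Sum>i\<in>{1..n}. lam i *\<^sub>R x i (J i))"

text \<open>Different choices may have the same mean; they then share one index, and their weights
  are merged there.\<close>

definition mean_index :: "(nat \<Rightarrow> nat) \<Rightarrow> nat" where
  "mean_index J = inv_into K X (mean J)"

definition lp_vars :: "(nat \<times> nat \<times> nat) set" where
  "lp_vars = {(i, j, k). i \<in> {1..n} \<and> j \<in> {1..N i} \<and> k \<in> S i j}"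

text \<open>Makes the first measure available as a reference: its equations determine
  \<open>z\<close> from \<open>y\<close>.\<close>

lemma n_pos: "1 \<in> {1..n}"
  using lam_sum by (cases n) auto

lemma finite_choices [simp]: "finite choices"
  by (auto simp: choices_def intro: finite_PiE)

lemma choices_in: "J \<in> choices \<Longrightarrow> i \<in> {1..n} \<Longrightarrow> J i \<in> {1..N i}"
  by (auto simp: choices_def PiE_def Pi_def)

lemma weighted_means_eq: "weighted_means n lam N x = mean ` choices"
proof (intro equalityI subsetI)
  fix p assume "p \<in> weighted_means n lam N x"
  then obtain J where J: "\<forall>i\<in>{1..n}. J i \<in> {1..N i}"
      and p: "p = (\<Sum>i\<in>{1..n}. lam i *\<^sub>R x i (J i))"
    unfolding weighted_means_def by blast
  show "p \<in> mean ` choices"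
  proof
    show "restrict J {1..n} \<in> choices"
      using J by (auto simp: choices_def)
    show "p = mean (restrict J {1..n})"
      unfolding p mean_def by (intro sum.cong) auto
  qed
next
  fix p assume "p \<in> mean ` choices"
  then obtain J where "J \<in> choices" "p = mean J" by blast
  then show "p \<in> weighted_means n lam N x"
    unfolding weighted_means_def mean_def using choices_in by blast
qed

lemma mean_index:
  assumes "J \<in> choices"
  shows "mean_index J \<in> K" "X (mean_index J) = mean J"
proof -
  have "mean J \<in> X ` K"
    using X_bij assms unfolding bij_betw_def weighted_means_eq by auto
  then show "mean_index J \<in> K" "X (mean_index J) = mean J"
    unfolding mean_index_def by (fact inv_into_into f_inv_into_f)+
qed

text \<open>The function in \<open>S_pair\<close> is arbitrary at \<open>i\<close> and outside the
  index range. Setting it to \<open>j\<close> at \<open>i\<close> and restricting it gives a choice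
  function, and injectivity of \<open>X\<close> identifies \<open>k\<close> as the index of its
  mean.\<close>

lemma S_iff:
  assumes "i \<in> {1..n}" "j \<in> {1..N i}"
  shows "k \<in> S i j \<longleftrightarrow> (\<exists>J\<in>choices. J i = j \<and> mean_index J = k)"
proof
  assume "k \<in> S i j"
  then obtain J where k: "k \<in> K" and J: "\<forall>l\<in>{1..n} - {i}. J l \<in> {1..N l}"
    and Xk: "X k = lam i *\<^sub>R x i j + (\<Sum>l\<in>{1..n} - {i}. lam l *\<^sub>R x l (J l))"
    unfolding S_pair_def by auto
  define J' where "J' = restrict (J(i := j)) {1..n}"
  have J': "J' \<in> choices" "J' i = j"
    using J assms by (auto simp: J'_def choices_def)
  have "mean J' = X k"
    unfolding Xk mean_def using assms
    by (subst sum.remove[of _ i]) (auto simp: J'_def intro!: sum.cong)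
  then have "mean_index J' = k"
    using k X_bij by (auto simp: mean_index_def bij_betw_def)
  with J' show "\<exists>J\<in>choices. J i = j \<and> mean_index J = k" by auto
next
  assume "\<exists>J\<in>choices. J i = j \<and> mean_index J = k"
  then obtain J where J: "J \<in> choices" "J i = j" "mean_index J = k" by auto
  have "X k = lam i *\<^sub>R x i j + (\<Sum>l\<in>{1..n} - {i}. lam l *\<^sub>R x l (J l))"
    using mean_index(2)[OF J(1)] J assms unfolding mean_def
    by (subst (asm) sum.remove[of _ i]) auto
  moreover have "\<forall>l\<in>{1..n} - {i}. J l \<in> {1..N l}"
    using choices_in[OF J(1)] by blast
  ultimately show "k \<in> S i j"
    using J(3) mean_index(1)[OF J(1)] unfolding S_pair_def by blast
qed

lemma S_subset: "S i j \<subseteq> K"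
  by (auto simp: S_pair_def)

lemma finite_S [simp]: "finite (S i j)"
  by (rule finite_subset[OF S_subset]) simp

lemma finite_lp_vars [simp]: "finite lp_vars"
proof (rule finite_subset)
  show "lp_vars \<subseteq> (SIGMA i:{1..n}. {1..N i} \<times> K)"
    using S_subset by (auto simp: lp_vars_def)
qed (auto intro: finite_SigmaI)

lemma S_single_section:
  "i \<in> {1..n} \<Longrightarrow> {j. (i, j) \<in> S_single n lam N x X k} = {j \<in> {1..N i}. k \<in> S i j}"
  by (auto simp: S_single_def)

text \<open>Coordinates outside \<open>lp_vars\<close> vanish, so the sign condition may be stated
  for all coordinates.\<close>

lemma feasible_iff:
  "(y, z) \<in> feasible \<longleftrightarrow>
     Poly_Mapping.keys y \<subseteq> lp_vars \<and> Poly_Mapping.keys z \<subseteq> K \<and>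
     (\<forall>i\<in>{1..n}. \<forall>k\<in>K.
        (\<Sum>j\<in>{j\<in>{1..N i}. k \<in> S i j}. Poly_Mapping.lookup y (i, j, k)) = Poly_Mapping.lookup z k) \<and>
     (\<forall>i\<in>{1..n}. \<forall>j\<in>{1..N i}. (\<Sum>k\<in>S i j. Poly_Mapping.lookup y (i, j, k)) = d i j) \<and>
     (\<forall>v. Poly_Mapping.lookup y v \<ge> 0)"
proof -
  have "(\<forall>v. Poly_Mapping.lookup y v \<ge> 0) \<longleftrightarrow>
     (\<forall>i\<in>{1..n}. \<forall>j\<in>{1..N i}. \<forall>k\<in>S i j. Poly_Mapping.lookup y (i, j, k) \<ge> 0)"
    if "Poly_Mapping.keys y \<subseteq> lp_vars"
  proof -
    have "Poly_Mapping.lookup y v \<ge> 0 \<longleftrightarrow> (v \<in> lp_vars \<longrightarrow> Poly_Mapping.lookup y v \<ge> 0)" for v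
      using that by (metis in_keys_iff order_refl subsetD)
    then show ?thesis
      by (auto simp: lp_vars_def)
  qed
  then show ?thesis
    unfolding lp_feasible_def lp_vars_def[symmetric] mem_Collect_eq case_prod_conv
    by (simp only: S_single_section cong: conj_cong ball_cong)
qed

section \<open>Feasible points from weightings of choice functions\<close>

definition choice_cost :: "(nat \<Rightarrow> nat) \<Rightarrow> real" where
  "choice_cost J = (\<Sum>i\<in>{1..n}. lam i * (norm (mean J - x i (J i)))\<^sup>2)"

text \<open>Take \<open>y (i, j, k)\<close> as the total weight of the choices that select
  \<open>j\<close> for measure \<open>i\<close> and have mean \<open>X k\<close>, and
  \<open>z k\<close> as the total weight of the choices with mean \<open>X k\<close>.\<close>

lemma feasible_of_choice_weights:
  assumes w_nonneg: "\<And>J. J \<in> choices \<Longrightarrow> w J \<ge> 0"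
    and w_marginal: "\<And>i j. i \<in> {1..n} \<Longrightarrow> j \<in> {1..N i} \<Longrightarrow>
      (\<Sum>J\<in>choices. of_bool (J i = j) * w J) = d i j"
  obtains y z where "(y, z) \<in> feasible" "cost y = (\<Sum>J\<in>choices. choice_cost J * w J)"
proof -
  define Y where "Y = (\<lambda>(i, j, k). \<Sum>J\<in>choices. w J * of_bool (J i = j \<and> mean_index J = k))"
  obtain y where y: "\<And>v. Poly_Mapping.lookup y v = (if v \<in> lp_vars then Y v else 0)"
    using exists_poly_mapping[OF finite_lp_vars, of Y] by blast
  obtain z where z: "\<And>k. Poly_Mapping.lookup z k =
      (if k \<in> K then \<Sum>J\<in>choices. w J * of_bool (mean_index J = k) else 0)"
    using exists_poly_mapping[of K "\<lambda>k. \<Sum>J\<in>choices. w J * of_bool (mean_index J = k)"] by blast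
  \<comment> \<open>Change of variables: summing \<open>F\<close> against the \<open>i\<close>-th
    block of \<open>y\<close> is summing its value at \<open>(J i, mean_index J)\<close> against
    \<open>w\<close>. Both families of equations and the cost are obtained from suitable
    \<open>F\<close>.\<close>
  have key: "(\<Sum>j\<in>{1..N i}. \<Sum>k\<in>S i j. F j k * Poly_Mapping.lookup y (i, j, k)) =
      (\<Sum>J\<in>choices. F (J i) (mean_index J) * w J)" if i: "i \<in> {1..n}" for i and F :: "nat \<Rightarrow> nat \<Rightarrow> real"
  proof -
    have "(\<Sum>j\<in>{1..N i}. \<Sum>k\<in>S i j. F j k * Poly_Mapping.lookup y (i, j, k)) =
        (\<Sum>j\<in>{1..N i}. \<Sum>k\<in>S i j. \<Sum>J\<in>choices. F j k * w J * of_bool (J i = j \<and> mean_index J = k))"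
      using i by (intro sum.cong refl) (simp add: y Y_def lp_vars_def sum_distrib_left mult.assoc
          del: sum_mult_of_bool_eq sum_of_bool_mult_eq)
    also have "\<dots> = (\<Sum>J\<in>choices. \<Sum>j\<in>{1..N i}. \<Sum>k\<in>S i j. F j k * w J * of_bool (J i = j \<and> mean_index J = k))"
      by (simp only: sum.swap[of _ choices])
    also have "\<dots> = (\<Sum>J\<in>choices. F (J i) (mean_index J) * w J)"
    proof (rule sum.cong[OF refl])
      fix J assume J: "J \<in> choices"
      have "(\<Sum>j\<in>{1..N i}. \<Sum>k\<in>S i j. F j k * w J * of_bool (J i = j \<and> mean_index J = k)) =
          (\<Sum>j\<in>{1..N i}. (\<Sum>k\<in>S i j. F j k * w J * of_bool (mean_index J = k)) * of_bool (J i = j))"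
        unfolding of_bool_conj sum_distrib_right by (intro sum.cong refl) (simp only: mult_ac)
      also have "\<dots> = (\<Sum>k\<in>S i (J i). F (J i) k * w J * of_bool (mean_index J = k))"
        using choices_in[OF J i] by (subst sum_mult_of_bool) auto
      \<comment> \<open>The index \<open>mean_index J\<close> lies in \<open>S i (J i)\<close>, so
        the indicator selects exactly one term.\<close>
      also have "\<dots> = F (J i) (mean_index J) * w J"
        using S_iff[OF i choices_in[OF J i]] J by (subst sum_mult_of_bool) auto
      finally show "(\<Sum>j\<in>{1..N i}. \<Sum>k\<in>S i j. F j k * w J * of_bool (J i = j \<and> mean_index J = k)) =
          F (J i) (mean_index J) * w J" .
    qed
    finally show ?thesis .
  qed
  have "(y, z) \<in> feasible"
    unfolding feasible_iff
  proof (intro conjI ballI allI)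
    show "Poly_Mapping.keys y \<subseteq> lp_vars" "Poly_Mapping.keys z \<subseteq> K"
      by (auto simp: in_keys_iff y z split: if_splits)
    show "Poly_Mapping.lookup y v \<ge> 0" for v
      by (auto simp: y Y_def split: prod.splits intro!: sum_nonneg w_nonneg)
    show "(\<Sum>j\<in>{j\<in>{1..N i}. k \<in> S i j}. Poly_Mapping.lookup y (i, j, k)) = Poly_Mapping.lookup z k"
      if "i \<in> {1..n}" "k \<in> K" for i k
    proof -
      have "(\<Sum>j\<in>{j\<in>{1..N i}. k \<in> S i j}. Poly_Mapping.lookup y (i, j, k)) =
          (\<Sum>j\<in>{1..N i}. \<Sum>k'\<in>S i j. of_bool (k = k') * Poly_Mapping.lookup y (i, j, k'))"
        by (subst sum.inter_filter) (auto intro!: sum.cong)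
      also have "\<dots> = (\<Sum>J\<in>choices. of_bool (k = mean_index J) * w J)"
        using that by (simp only: key)
      also have "\<dots> = Poly_Mapping.lookup z k"
        using that by (simp only: z if_True eq_commute[of k] mult.commute[of "w _"])
      finally show ?thesis .
    qed
    show "(\<Sum>k\<in>S i j. Poly_Mapping.lookup y (i, j, k)) = d i j" if "i \<in> {1..n}" "j \<in> {1..N i}" for i j
    proof -
      have "(\<Sum>k\<in>S i j. Poly_Mapping.lookup y (i, j, k)) =
          (\<Sum>j'\<in>{1..N i}. (\<Sum>k\<in>S i j'. Poly_Mapping.lookup y (i, j', k)) * of_bool (j = j'))"
        using that by (subst sum_mult_of_bool) auto
      also have "\<dots> = (\<Sum>j'\<in>{1..N i}. \<Sum>k\<in>S i j'. of_bool (j' = j) * Poly_Mapping.lookup y (i, j', k))"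
        unfolding sum_distrib_right
        by (intro sum.cong refl) (simp add: mult.commute eq_commute[of j])
      also have "\<dots> = d i j"
        using that by (simp only: key w_marginal)
      finally show ?thesis .
    qed
  qed
  moreover have "cost y = (\<Sum>J\<in>choices. choice_cost J * w J)"
  proof -
    have "cost y = (\<Sum>i\<in>{1..n}. lam i * (\<Sum>J\<in>choices. (norm (mean J - x i (J i)))\<^sup>2 * w J))"
      unfolding lp_cost_def by (intro sum.cong refl) (simp only: key mean_index(2) cong: sum.cong)
    also have "\<dots> = (\<Sum>J\<in>choices. choice_cost J * w J)"
      unfolding choice_cost_def sum_distrib_left sum_distrib_right
      by (subst sum.swap) (simp add: mult.assoc)
    finally show ?thesis .
  qed
  ultimately show thesis using that by blast
qed

text \<open>Absorb \<open>h\<close> into the \<open>i\<close>-th factor and expand a product of sums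
  over choice functions; every other factor sums to 1. The general semiring covers real masses as
  well as extended nonnegative densities.\<close>

lemma sum_choices_marginal:
  fixes f :: "nat \<Rightarrow> nat \<Rightarrow> 'b::comm_semiring_1"
  assumes i: "i \<in> {1..n}" and f: "\<And>l. l \<in> {1..n} \<Longrightarrow> (\<Sum>j\<in>{1..N l}. f l j) = 1"
  shows "(\<Sum>J\<in>choices. h (J i) * (\<Prod>l\<in>{1..n}. f l (J l))) = (\<Sum>j\<in>{1..N i}. h j * f i j)"
proof -
  define g where "g l j = (if l = i then h j * f l j else f l j)" for l j
  have "h (J i) * (\<Prod>l\<in>{1..n}. f l (J l)) = (\<Prod>l\<in>{1..n}. g l (J l))" for J
  proof -
    have "(\<Prod>l\<in>{1..n} - {i}. g l (J l)) = (\<Prod>l\<in>{1..n} - {i}. f l (J l))"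
      by (intro prod.cong) (auto simp: g_def)
    then show ?thesis
      unfolding prod.remove[OF finite_atLeastAtMost i] by (simp add: g_def mult.assoc)
  qed
  then have "(\<Sum>J\<in>choices. h (J i) * (\<Prod>l\<in>{1..n}. f l (J l))) = (\<Prod>l\<in>{1..n}. \<Sum>j\<in>{1..N l}. g l j)"
    unfolding choices_def by (subst prod_sum_PiE) auto
  also have "\<dots> = (\<Sum>j\<in>{1..N i}. h j * f i j) * (\<Prod>l\<in>{1..n} - {i}. \<Sum>j\<in>{1..N l}. f l j)"
    using i by (subst prod.remove[of _ i]) (auto simp: g_def)
  also have "(\<Prod>l\<in>{1..n} - {i}. \<Sum>j\<in>{1..N l}. f l j) = 1"
    using f by (intro prod.neutral) auto
  finally show ?thesis by simp
qed

text \<open>The product of the given measures, as a weighting of the choices, has the required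
  marginals.\<close>

lemma feasible_nonempty: "feasible \<noteq> {}"
proof -
  define w where "w J = (\<Prod>l\<in>{1..n}. d l (J l))" for J
  have "w J \<ge> 0" if "J \<in> choices" for J
    unfolding w_def using that by (intro prod_nonneg ballI less_imp_le d_pos choices_in)
  moreover have "(\<Sum>J\<in>choices. of_bool (J i = j) * w J) = d i j"
    if "i \<in> {1..n}" "j \<in> {1..N i}" for i j
    unfolding w_def
    using that d_sum sum_choices_marginal[OF that(1), where h = "\<lambda>m. of_bool (m = j)" and f = d]
    by (auto simp: of_bool_def if_distrib if_distribR cong: if_cong)
  ultimately obtain y z where "(y, z) \<in> feasible"
    by (rule feasible_of_choice_weights)
  then show ?thesis by blast
qed

section \<open>Compactness of the feasible set and existence of an optimal solution\<close>

lemma lookup_outside_vars: "(y, z) \<in> feasible \<Longrightarrow> v \<notin> lp_vars \<Longrightarrow> Poly_Mapping.lookup y v = 0"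
  unfolding feasible_iff by (metis in_keys_iff subsetD)

lemma lookup_nonneg: "(y, z) \<in> feasible \<Longrightarrow> Poly_Mapping.lookup y v \<ge> 0"
  unfolding feasible_iff by (elim conjE) (rule spec)

lemma lookup_le_one:
  assumes yz: "(y, z) \<in> feasible"
  shows "Poly_Mapping.lookup y v \<le> 1"
proof (cases "v \<in> lp_vars")
  case True
  then obtain i j k where v: "v = (i, j, k)" "i \<in> {1..n}" "j \<in> {1..N i}" "k \<in> S i j"
    unfolding lp_vars_def by blast
  have "Poly_Mapping.lookup y v \<le> (\<Sum>k\<in>S i j. Poly_Mapping.lookup y (i, j, k))"
    unfolding v(1) using v(4) lookup_nonneg[OF yz] by (intro member_le_sum) auto
  also have "\<dots> = d i j"
    using yz v by (simp add: feasible_iff)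
  also have "\<dots> \<le> (\<Sum>j\<in>{1..N i}. d i j)"
    using v(2,3) by (intro member_le_sum) (auto intro!: less_imp_le d_pos)
  finally show ?thesis using d_sum[OF v(2)] by simp
qed (simp add: lookup_outside_vars[OF yz])

text \<open>The LP equations with \<open>z\<close> eliminated: at each \<open>k\<close>, every
  measure must deposit the same mass as the first one. Signs and vanishing coordinates are left to
  the box that is intersected with this set.\<close>

definition feasible_fun :: "(nat \<times> nat \<times> nat \<Rightarrow> real) \<Rightarrow> bool" where
  "feasible_fun f \<longleftrightarrow> (\<forall>i\<in>{1..n}. \<forall>k\<in>K. (\<Sum>j\<in>{j\<in>{1..N i}. k \<in> S i j}. f (i, j, k)) =
        (\<Sum>j\<in>{j\<in>{1..N 1}. k \<in> S 1 j}. f (1, j, k))) \<and>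
     (\<forall>i\<in>{1..n}. \<forall>j\<in>{1..N i}. (\<Sum>k\<in>S i j. f (i, j, k)) = d i j)"

text \<open>Presents the \<open>y\<close>-parts of feasible points as a product of compact sets cut
  by equations, in the space of all functions with the product topology.\<close>

lemma lookup_feasible_eq:
  "(Poly_Mapping.lookup \<circ> fst) ` feasible =
     (\<Pi>\<^sub>E v\<in>UNIV. if v \<in> lp_vars then {0..1} else {0}) \<inter> Collect feasible_fun"
proof (intro equalityI subsetI)
  fix f assume "f \<in> (Poly_Mapping.lookup \<circ> fst) ` feasible"
  then obtain y z where yz: "(y, z) \<in> feasible" "f = Poly_Mapping.lookup y" by auto
  then show "f \<in> (\<Pi>\<^sub>E v\<in>UNIV. if v \<in> lp_vars then {0..1} else {0}) \<inter> Collect feasible_fun"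
    using lookup_nonneg[OF yz(1)] lookup_le_one[OF yz(1)] lookup_outside_vars[OF yz(1)] n_pos
    by (auto simp: feasible_fun_def feasible_iff simp del: One_nat_def)
next
  fix f assume f: "f \<in> (\<Pi>\<^sub>E v\<in>UNIV. if v \<in> lp_vars then {0..1} else {0}) \<inter> Collect feasible_fun"
  then have f01: "f v \<in> (if v \<in> lp_vars then {0..1} else {0})" for v
    by blast
  obtain y where y: "\<And>v. Poly_Mapping.lookup y v = (if v \<in> lp_vars then f v else 0)"
    using exists_poly_mapping[OF finite_lp_vars, of f] by blast
  have y_eq: "Poly_Mapping.lookup y v = f v" for v
    using f01[of v] by (auto simp: y)
  \<comment> \<open>The eliminated variable is recovered from the block of the first
    measure.\<close>
  obtain z where z: "\<And>k. Poly_Mapping.lookup z k =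
      (if k \<in> K then \<Sum>j\<in>{j\<in>{1..N 1}. k \<in> S 1 j}. f (1, j, k) else 0)"
    using exists_poly_mapping[of K "\<lambda>k. \<Sum>j\<in>{j\<in>{1..N 1}. k \<in> S 1 j}. f (1, j, k)"] by blast
  have "(y, z) \<in> feasible"
    unfolding feasible_iff
  proof (intro conjI)
    show "Poly_Mapping.keys y \<subseteq> lp_vars" "Poly_Mapping.keys z \<subseteq> K"
      by (auto simp: in_keys_iff y z split: if_splits)
    show "\<forall>v. Poly_Mapping.lookup y v \<ge> 0"
    proof
      fix v
      show "Poly_Mapping.lookup y v \<ge> 0"
        using f01[of v] by (cases "v \<in> lp_vars") (simp_all add: y)
    qed
    have ff: "feasible_fun f" using f by blast
    then show "\<forall>i\<in>{1..n}. \<forall>j\<in>{1..N i}. (\<Sum>k\<in>S i j. Poly_Mapping.lookup y (i, j, k)) = d i j"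
      unfolding feasible_fun_def y_eq by blast
    show "\<forall>i\<in>{1..n}. \<forall>k\<in>K. (\<Sum>j\<in>{j\<in>{1..N i}. k \<in> S i j}. Poly_Mapping.lookup y (i, j, k)) =
        Poly_Mapping.lookup z k"
      using ff by (simp only: feasible_fun_def y_eq z if_True cong: ball_cong) blast
  qed
  moreover have "f = Poly_Mapping.lookup y"
    using y_eq by (intro ext) simp
  ultimately show "f \<in> (Poly_Mapping.lookup \<circ> fst) ` feasible"
    by (intro image_eqI[of _ _ "(y, z)"]) simp_all
qed

text \<open>The box is compact by Tychonoff, and the equations between continuous functions of the
  coordinates define a closed set.\<close>

lemma compact_feasible: "compact ((Poly_Mapping.lookup \<circ> fst) ` feasible)"
  unfolding lookup_feasible_eq
proof (rule compact_Int_closed)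
  have "compactin (product_topology (\<lambda>_. euclidean) UNIV)
      (\<Pi>\<^sub>E v\<in>UNIV. if v \<in> lp_vars then {0..1} else {0::real})"
    unfolding compactin_PiE by auto
  then show "compact (\<Pi>\<^sub>E v\<in>UNIV. if v \<in> lp_vars then {0..1} else {0::real})"
    by (simp add: euclidean_product_topology)
  have coord: "continuous_on UNIV (\<lambda>f. f v)" for v :: "nat \<times> nat \<times> nat"
    by (rule continuous_on_product_coordinates)
  show "closed (Collect feasible_fun)"
    unfolding feasible_fun_def Ball_def
    by (intro closed_Collect_conj closed_Collect_all closed_Collect_imp closed_Collect_eq
        open_Collect_const continuous_intros coord)
qed

text \<open>The cost involves only finitely many coordinates of \<open>y\<close> and is continuous
  in them, so it attains its minimum on the compact nonempty set of \<open>y\<close>-parts.\<close>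

lemma optimal_nonempty: "lp_optimal n lam N x d X \<noteq> {}"
proof -
  define c where "c f = (\<Sum>i\<in>{1..n}. lam i * (\<Sum>j\<in>{1..N i}. \<Sum>k\<in>S i j.
     (norm (X k - x i j))\<^sup>2 * f (i, j, k)))" for f :: "nat \<times> nat \<times> nat \<Rightarrow> real"
  have "continuous_on UNIV c"
    unfolding c_def by (intro continuous_intros continuous_on_product_coordinates)
  then have "continuous_on ((Poly_Mapping.lookup \<circ> fst) ` feasible) c"
    by (rule continuous_on_subset) simp
  then obtain f where f: "f \<in> (Poly_Mapping.lookup \<circ> fst) ` feasible"
    and min: "\<And>g. g \<in> (Poly_Mapping.lookup \<circ> fst) ` feasible \<Longrightarrow> c f \<le> c g"
    using continuous_attains_inf[OF compact_feasible] feasible_nonempty by blast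
  from f obtain y z where yz: "(y, z) \<in> feasible" "f = Poly_Mapping.lookup y" by auto
  have c: "cost y = c (Poly_Mapping.lookup y)" for y
    by (simp add: lp_cost_def c_def)
  have "(y, z) \<in> lp_optimal n lam N x d X"
    unfolding lp_optimal_def
  proof safe
    fix y' z' assume "(y', z') \<in> feasible"
    then show "cost y \<le> cost y'"
      using min[of "Poly_Mapping.lookup y'"] by (force simp: yz(2) c)
  qed (fact yz(1))
  then show ?thesis by blast
qed

lemma lookup_z_eq:
  "(y, z) \<in> feasible \<Longrightarrow> i \<in> {1..n} \<Longrightarrow> k \<in> K \<Longrightarrow>
    Poly_Mapping.lookup z k = (\<Sum>j\<in>{j\<in>{1..N i}. k \<in> S i j}. Poly_Mapping.lookup y (i, j, k))"
  by (simp add: feasible_iff)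

lemma lookup_z_nonneg:
  assumes "(y, z) \<in> feasible"
  shows "Poly_Mapping.lookup z k \<ge> 0"
proof (cases "k \<in> K")
  case True
  then show ?thesis
    unfolding lookup_z_eq[OF assms n_pos True] by (intro sum_nonneg lookup_nonneg[OF assms])
next
  case False
  then have "Poly_Mapping.lookup z k = 0"
    using assms unfolding feasible_iff by (metis in_keys_iff subsetD)
  then show ?thesis by simp
qed

subsection \<open>Barycenters from optimal solutions\<close>

text \<open>\<open>sum_choices_marginal\<close> is applied at almost every \<open>p\<close> and then
  integrated; the exceptional null sets for the finitely many measures are combined.\<close>

lemma sum_choices_integral_marginal:
  fixes Q :: "'a measure" and h :: "nat \<Rightarrow> 'a \<Rightarrow> ennreal"
  assumes Q: "sets Q = sets borel"
    and g: "\<And>i j. i \<in> {1..n} \<Longrightarrow> j \<in> {1..N i} \<Longrightarrow> g i j \<in> borel_measurable borel"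
    and g_sum: "\<And>i. i \<in> {1..n} \<Longrightarrow> AE p in Q. (\<Sum>j\<in>{1..N i}. g i j p) = 1"
    and i: "i \<in> {1..n}"
    and h: "\<And>j. h j \<in> borel_measurable borel"
  shows "(\<Sum>J\<in>choices. \<integral>\<^sup>+ p. h (J i) p * (\<Prod>l\<in>{1..n}. g l (J l) p) \<partial>Q) =
    (\<Sum>j\<in>{1..N i}. \<integral>\<^sup>+ p. h j p * g i j p \<partial>Q)"
proof -
  have meas: "f \<in> borel_measurable borel \<Longrightarrow> f \<in> borel_measurable Q" for f :: "'a \<Rightarrow> ennreal"
    using Q by (simp cong: measurable_cong_sets)
  have "(\<Sum>J\<in>choices. \<integral>\<^sup>+ p. h (J i) p * (\<Prod>l\<in>{1..n}. g l (J l) p) \<partial>Q) =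
      (\<integral>\<^sup>+ p. (\<Sum>J\<in>choices. h (J i) p * (\<Prod>l\<in>{1..n}. g l (J l) p)) \<partial>Q)"
    by (intro nn_integral_sum[symmetric] meas borel_measurable_times_ennreal
        borel_measurable_prod_ennreal h g choices_in)
  also have "\<dots> = (\<integral>\<^sup>+ p. (\<Sum>j\<in>{1..N i}. h j p * g i j p) \<partial>Q)"
  proof (rule nn_integral_cong_AE)
    have "AE p in Q. \<forall>l\<in>{1..n}. (\<Sum>j\<in>{1..N l}. g l j p) = 1"
      using g_sum by (intro AE_finite_allI) auto
    then show "AE p in Q. (\<Sum>J\<in>choices. h (J i) p * (\<Prod>l\<in>{1..n}. g l (J l) p)) =
        (\<Sum>j\<in>{1..N i}. h j p * g i j p)"
      by eventually_elim (rule sum_choices_marginal[OF i], blast)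
  qed
  also have "\<dots> = (\<Sum>j\<in>{1..N i}. \<integral>\<^sup>+ p. h j p * g i j p \<partial>Q)"
    by (intro nn_integral_sum meas borel_measurable_times_ennreal h g i)
  finally show ?thesis .
qed

lemma choice_cost_le: "choice_cost J \<le> (\<Sum>i\<in>{1..n}. lam i * (norm (p - x i (J i)))\<^sup>2)"
  unfolding choice_cost_def mean_def by (rule sum_sq_dist_weighted_mean_le[OF lam_sum])

lemma lam_nonneg: "i \<in> {1..n} \<Longrightarrow> 0 \<le> lam i"
  by (rule less_imp_le[OF lam_pos])

lemma choice_cost_nonneg: "choice_cost J \<ge> 0"
  unfolding choice_cost_def by (intro sum_nonneg mult_nonneg_nonneg lam_nonneg) auto

text \<open>The gluing of the couplings along \<open>Q\<close> weights the choices. Replacing the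
  common point \<open>p\<close> by the mean of each choice cannot increase the cost, whence the
  inequality.\<close>

lemma feasible_cost_le_couplings:
  assumes P: "\<And>i. i \<in> {1..n} \<Longrightarrow> discrete_prob (P i) (N i) (x i) (d i)"
    and Q: "Q \<in> prob2"
    and G: "\<And>i. i \<in> {1..n} \<Longrightarrow> G i \<in> couplings Q (P i)"
  obtains y z where "(y, z) \<in> feasible"
    "ennreal (cost y) \<le> (\<Sum>i\<in>{1..n}. ennreal (lam i) * (\<integral>\<^sup>+ q. ennreal ((norm (fst q - snd q))\<^sup>2) \<partial>G i))"
proof -
  have Q_prob: "prob_space Q" and Q_sets: "sets Q = sets borel"
    using Q by (auto simp: prob2_def)
  have meas: "f \<in> borel_measurable borel \<Longrightarrow> f \<in> borel_measurable Q" for f :: "'a \<Rightarrow> ennreal"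
    using Q_sets by (simp cong: measurable_cong_sets)
  \<comment> \<open>Bundles the properties of the conditional densities into one predicate, so that
    a family \<open>g\<close> can be chosen for all measures at once.\<close>
  define dens where "dens i g \<longleftrightarrow>
      (\<forall>j\<in>{1..N i}. g j \<in> borel_measurable borel \<and> (\<integral>\<^sup>+ p. g j p \<partial>Q) = ennreal (d i j)) \<and>
      (AE p in Q. (\<Sum>j\<in>{1..N i}. g j p) = 1) \<and>
      (\<integral>\<^sup>+ q. ennreal ((norm (fst q - snd q))\<^sup>2) \<partial>G i) =
      (\<Sum>j\<in>{1..N i}. \<integral>\<^sup>+ p. ennreal ((norm (p - x i j))\<^sup>2) * g j p \<partial>Q)"
    for i and g :: "nat \<Rightarrow> 'a \<Rightarrow> ennreal"
  have "\<forall>i\<in>{1..n}. \<exists>g. dens i g"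
  proof
    fix i assume "i \<in> {1..n}"
    show "\<exists>g. dens i g"
      by (rule coupling_densities[OF Q_prob Q_sets P[OF \<open>i \<in> {1..n}\<close>] G[OF \<open>i \<in> {1..n}\<close>]],
          rule exI, unfold dens_def, intro conjI ballI)
  qed
  then obtain g where "\<forall>i\<in>{1..n}. dens i (g i)"
    using bchoice[of "{1..n}" dens] by blast
  then have g_meas: "\<And>i j. i \<in> {1..n} \<Longrightarrow> j \<in> {1..N i} \<Longrightarrow> g i j \<in> borel_measurable borel"
    and g_int: "\<And>i j. i \<in> {1..n} \<Longrightarrow> j \<in> {1..N i} \<Longrightarrow> (\<integral>\<^sup>+ p. g i j p \<partial>Q) = ennreal (d i j)"
    and g_sum: "\<And>i. i \<in> {1..n} \<Longrightarrow> AE p in Q. (\<Sum>j\<in>{1..N i}. g i j p) = 1"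
    and g_cost: "\<And>i. i \<in> {1..n} \<Longrightarrow> (\<integral>\<^sup>+ q. ennreal ((norm (fst q - snd q))\<^sup>2) \<partial>G i) =
      (\<Sum>j\<in>{1..N i}. \<integral>\<^sup>+ p. ennreal ((norm (p - x i j))\<^sup>2) * g i j p \<partial>Q)"
    unfolding dens_def by blast+
  note marginal = sum_choices_integral_marginal[OF Q_sets g_meas g_sum]
  \<comment> \<open>Given the \<open>Q\<close>-coordinate \<open>p\<close>, the second coordinates
    are made independent; \<open>\<pi> J p\<close> is the conditional probability of the choice
    \<open>J\<close>, and \<open>W J\<close> below its total probability.\<close>
  define \<pi> where "\<pi> J p = (\<Prod>l\<in>{1..n}. g l (J l) p)" for J p
  have \<pi>_meas: "\<pi> J \<in> borel_measurable borel" if "J \<in> choices" for J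
    unfolding \<pi>_def by (intro borel_measurable_prod_ennreal g_meas choices_in that)
  define W where "W J = (\<integral>\<^sup>+ p. \<pi> J p \<partial>Q)" for J
  have W_marginal: "(\<Sum>J\<in>choices. of_bool (J i = j) * W J) = ennreal (d i j)"
    if i: "i \<in> {1..n}" and j: "j \<in> {1..N i}" for i j
  proof -
    have "(\<Sum>J\<in>choices. of_bool (J i = j) * W J) =
        (\<Sum>J\<in>choices. \<integral>\<^sup>+ p. of_bool (J i = j) * \<pi> J p \<partial>Q)"
      unfolding W_def by (intro sum.cong refl nn_integral_cmult[symmetric] meas \<pi>_meas)
    also have "\<dots> = (\<Sum>j'\<in>{1..N i}. \<integral>\<^sup>+ p. of_bool (j' = j) * g i j' p \<partial>Q)"
      unfolding \<pi>_def by (rule marginal[OF _ _ _ i, of "\<lambda>j' _. of_bool (j' = j)"]) auto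
    also have "\<dots> = (\<Sum>j'\<in>{1..N i}. ennreal (d i j') * of_bool (j = j'))"
    proof (intro sum.cong refl)
      fix j' assume "j' \<in> {1..N i}"
      then show "(\<integral>\<^sup>+ p. of_bool (j' = j) * g i j' p \<partial>Q) = ennreal (d i j') * of_bool (j = j')"
        using g_int[OF i] by (cases "j = j'") auto
    qed
    also have "\<dots> = ennreal (d i j)"
      using j by (subst sum_mult_of_bool) auto
    finally show ?thesis .
  qed
  \<comment> \<open>Bounded by a mass of the first measure, the weights are finite and can be turned
    into the real weights \<open>w\<close>.\<close>
  have W_finite: "W J < top" if J: "J \<in> choices" for J
  proof -
    have "W J \<le> (\<Sum>J'\<in>choices. of_bool (J' 1 = J 1) * W J')"
      using member_le_sum[of J choices "\<lambda>J'. of_bool (J' 1 = J 1) * W J'"] J by simp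
    also have "\<dots> = ennreal (d 1 (J 1))"
      by (rule W_marginal[OF n_pos choices_in[OF J n_pos]])
    finally show ?thesis by (rule le_less_trans) simp
  qed
  define w where "w J = enn2real (W J)" for J
  have w: "ennreal (w J) = W J" if "J \<in> choices" for J
    using W_finite[OF that] by (simp add: w_def)
  have w_nonneg: "w J \<ge> 0" for J
    by (simp add: w_def)
  have w_sum: "ennreal (\<Sum>J\<in>choices. c J * w J) = (\<Sum>J\<in>choices. ennreal (c J) * W J)"
    if c: "\<And>J. c J \<ge> 0" for c
  proof -
    have "ennreal (\<Sum>J\<in>choices. c J * w J) = (\<Sum>J\<in>choices. ennreal (c J * w J))"
      using c w_nonneg by (intro sum_ennreal[symmetric]) simp
    also have "\<dots> = (\<Sum>J\<in>choices. ennreal (c J) * W J)"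
      using c w_nonneg by (intro sum.cong refl) (simp add: ennreal_mult w)
    finally show ?thesis .
  qed
  have w_marginal: "(\<Sum>J\<in>choices. of_bool (J i = j) * w J) = d i j"
    if i: "i \<in> {1..n}" and j: "j \<in> {1..N i}" for i j
  proof -
    have "ennreal (\<Sum>J\<in>choices. of_bool (J i = j) * w J) = (\<Sum>J\<in>choices. of_bool (J i = j) * W J)"
      by (subst w_sum) (auto simp: of_bool_def if_distrib cong: if_cong)
    also have "\<dots> = ennreal (d i j)"
      by (rule W_marginal[OF i j])
    finally show ?thesis
      using less_imp_le[OF d_pos[OF i j]] w_nonneg by (subst (asm) ennreal_inj) (auto intro!: sum_nonneg)
  qed
  obtain y z where yz: "(y, z) \<in> feasible" "cost y = (\<Sum>J\<in>choices. choice_cost J * w J)"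
    by (rule feasible_of_choice_weights[of w, OF w_nonneg w_marginal])
  have "ennreal (cost y) = (\<Sum>J\<in>choices. ennreal (choice_cost J) * W J)"
    unfolding yz(2) by (rule w_sum[OF choice_cost_nonneg])
  also have "\<dots> = (\<Sum>J\<in>choices. \<integral>\<^sup>+ p. ennreal (choice_cost J) * \<pi> J p \<partial>Q)"
    unfolding W_def by (intro sum.cong refl nn_integral_cmult[symmetric] meas \<pi>_meas)
  \<comment> \<open>The decisive inequality, valid for every \<open>J\<close> and every
    \<open>p\<close>: the weighted mean minimizes the weighted sum of squared distances.\<close>
  also have "\<dots> \<le> (\<Sum>J\<in>choices. \<integral>\<^sup>+ p. (\<Sum>i\<in>{1..n}. ennreal (lam i) * ennreal ((norm (p - x i (J i)))\<^sup>2)) * \<pi> J p \<partial>Q)"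
  proof (intro sum_mono nn_integral_mono mult_right_mono)
    fix J p
    have "ennreal (choice_cost J) \<le> ennreal (\<Sum>i\<in>{1..n}. lam i * (norm (p - x i (J i)))\<^sup>2)"
      by (intro ennreal_leI choice_cost_le)
    also have "\<dots> = (\<Sum>i\<in>{1..n}. ennreal (lam i) * ennreal ((norm (p - x i (J i)))\<^sup>2))"
      using lam_nonneg by (subst sum_ennreal[symmetric]) (auto simp: ennreal_mult intro!: sum.cong)
    finally show "ennreal (choice_cost J) \<le> (\<Sum>i\<in>{1..n}. ennreal (lam i) * ennreal ((norm (p - x i (J i)))\<^sup>2))" .
  qed simp
  also have "\<dots> = (\<Sum>J\<in>choices. \<Sum>i\<in>{1..n}. ennreal (lam i) * (\<integral>\<^sup>+ p. ennreal ((norm (p - x i (J i)))\<^sup>2) * \<pi> J p \<partial>Q))"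
  proof (intro sum.cong refl)
    fix J assume J: "J \<in> choices"
    note [measurable] = \<pi>_meas[OF J]
    show "(\<integral>\<^sup>+ p. (\<Sum>i\<in>{1..n}. ennreal (lam i) * ennreal ((norm (p - x i (J i)))\<^sup>2)) * \<pi> J p \<partial>Q) =
        (\<Sum>i\<in>{1..n}. ennreal (lam i) * (\<integral>\<^sup>+ p. ennreal ((norm (p - x i (J i)))\<^sup>2) * \<pi> J p \<partial>Q))"
      unfolding sum_distrib_right mult.assoc
      by (subst nn_integral_sum) (auto intro!: meas sum.cong nn_integral_cmult)
  qed
  also have "\<dots> = (\<Sum>i\<in>{1..n}. ennreal (lam i) * (\<Sum>J\<in>choices. \<integral>\<^sup>+ p. ennreal ((norm (p - x i (J i)))\<^sup>2) * \<pi> J p \<partial>Q))"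
    unfolding sum_distrib_left by (rule sum.swap)
  \<comment> \<open>For fixed \<open>i\<close>, the integrand depends on \<open>J\<close> only
    through \<open>J i\<close>, so the product collapses to the density of the \<open>i\<close>-th
    coupling.\<close>
  also have "\<dots> = (\<Sum>i\<in>{1..n}. ennreal (lam i) * (\<integral>\<^sup>+ q. ennreal ((norm (fst q - snd q))\<^sup>2) \<partial>G i))"
  proof (intro sum.cong refl)
    fix i assume i: "i \<in> {1..n}"
    show "ennreal (lam i) * (\<Sum>J\<in>choices. \<integral>\<^sup>+ p. ennreal ((norm (p - x i (J i)))\<^sup>2) * \<pi> J p \<partial>Q) =
        ennreal (lam i) * (\<integral>\<^sup>+ q. ennreal ((norm (fst q - snd q))\<^sup>2) \<partial>G i)"
      unfolding g_cost[OF i] \<pi>_def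
      by (subst marginal[OF _ _ _ i, of "\<lambda>j p. ennreal ((norm (p - x i j))\<^sup>2)"]) auto
  qed
  finally show thesis
    using that yz(1) by blast
qed

section \<open>Feasible points as transport plans\<close>

lemma sum_over_S:
  assumes "i \<in> {1..n}"
  shows "(\<Sum>j\<in>{1..N i}. \<Sum>k\<in>S i j. \<phi> j k) = (\<Sum>k\<in>K. \<Sum>j\<in>{j\<in>{1..N i}. k \<in> S i j}. \<phi> j k)"
proof -
  have "(\<Sum>j\<in>{1..N i}. \<Sum>k\<in>S i j. \<phi> j k) = (\<Sum>j\<in>{1..N i}. \<Sum>k\<in>{k \<in> K. k \<in> S i j}. \<phi> j k)"
    using S_subset by (intro sum.cong refl) blast
  also have "\<dots> = (\<Sum>k\<in>K. \<Sum>j\<in>{j\<in>{1..N i}. k \<in> S i j}. \<phi> j k)"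
    by (rule sum.swap_restrict) auto
  finally show ?thesis .
qed

text \<open>The mass of the first measure is counted by weighted means and by support
  points.\<close>

lemma sum_z:
  assumes yz: "(y, z) \<in> feasible"
  shows "(\<Sum>k\<in>K. Poly_Mapping.lookup z k) = 1"
proof -
  have "(\<Sum>k\<in>K. Poly_Mapping.lookup z k) = (\<Sum>j\<in>{1..N 1}. \<Sum>k\<in>S 1 j. Poly_Mapping.lookup y (1, j, k))"
    unfolding sum_over_S[OF n_pos] by (intro sum.cong refl lookup_z_eq[OF yz n_pos])
  also have "\<dots> = (\<Sum>j\<in>{1..N 1}. d 1 j)"
    using yz n_pos unfolding feasible_iff by (intro sum.cong refl) blast
  finally show ?thesis using d_sum[OF n_pos] by simp
qed

abbreviation "bary z \<equiv> dirac_sum K (Poly_Mapping.lookup z) X"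

lemma bary_prob2:
  assumes yz: "(y, z) \<in> feasible"
  shows "bary z \<in> prob2"
proof -
  have "emeasure (bary z) UNIV = 1"
    unfolding dirac_sum_def using sum_z[OF yz] lookup_z_nonneg[OF yz]
    by (subst emeasure_distr_point_measure) (auto simp: sum_ennreal)
  then have "prob_space (bary z)"
    by (intro prob_spaceI) (simp add: dirac_sum_def)
  moreover have "(\<integral>\<^sup>+ p. ennreal ((norm p)\<^sup>2) \<partial>bary z) < \<infinity>"
    unfolding dirac_sum_def
    by (subst nn_integral_distr_point_measure) (auto simp: ennreal_mult_less_top)
  ultimately show ?thesis
    by (simp add: prob2_def dirac_sum_def)
qed

text \<open>Placing mass \<open>y (i, j, k)\<close> at the pair \<open>(X k, x i j)\<close> gives a
  coupling: the two families of LP equations are its marginal conditions, and its transport cost is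
  the \<open>i\<close>-th part of the LP cost.\<close>

lemma W2_squared_bary_le:
  assumes P: "discrete_prob (P i) (N i) (x i) (d i)" and i: "i \<in> {1..n}" and yz: "(y, z) \<in> feasible"
  shows "W2_squared (bary z) (P i) \<le>
    ennreal (\<Sum>j\<in>{1..N i}. \<Sum>k\<in>S i j. (norm (X k - x i j))\<^sup>2 * Poly_Mapping.lookup y (i, j, k))"
proof -
  define V where "V = (SIGMA j:{1..N i}. S i j)"
  define f where "f = (\<lambda>(j, k). ennreal (Poly_Mapping.lookup y (i, j, k)))"
  define \<tau> where "\<tau> = (\<lambda>(j, k). (X k, x i j))"
  define G where "G = distr (point_measure V f) (borel \<Otimes>\<^sub>M borel) \<tau>"
  have V [simp]: "finite V" unfolding V_def by simp
  have \<tau>: "\<tau> \<in> V \<rightarrow> space (borel \<Otimes>\<^sub>M borel)" by (simp add: space_pair_measure)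
  have sum_V: "(\<Sum>v\<in>V. \<phi> v) = (\<Sum>j\<in>{1..N i}. \<Sum>k\<in>S i j. \<phi> (j, k))" for \<phi> :: "nat \<times> nat \<Rightarrow> ennreal"
    unfolding V_def by (subst sum.Sigma) auto
  have y_nonneg: "Poly_Mapping.lookup y v \<ge> 0" for v by (rule lookup_nonneg[OF yz])
  have "distr G borel fst = bary z"
  proof (rule measure_eqI)
    fix A :: "'a set" assume "A \<in> sets (distr G borel fst)"
    then have A: "A \<in> sets borel" by simp
    have "emeasure (distr G borel fst) A = (\<Sum>v\<in>V. f v * indicator A ((fst \<circ> \<tau>) v))"
      unfolding G_def using \<tau> A
      by (subst distr_distr, simp, simp) (intro emeasure_distr_point_measure, auto)
    also have "\<dots> = (\<Sum>k\<in>K. \<Sum>j\<in>{j\<in>{1..N i}. k \<in> S i j}. ennreal (Poly_Mapping.lookup y (i, j, k)) * indicator A (X k))"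
      unfolding sum_V sum_over_S[OF i] by (simp add: f_def \<tau>_def)
    also have "\<dots> = (\<Sum>k\<in>K. ennreal (Poly_Mapping.lookup z k) * indicator A (X k))"
    proof (intro sum.cong refl)
      fix k assume k: "k \<in> K"
      show "(\<Sum>j\<in>{j\<in>{1..N i}. k \<in> S i j}. ennreal (Poly_Mapping.lookup y (i, j, k)) * indicator A (X k)) =
          ennreal (Poly_Mapping.lookup z k) * indicator A (X k)"
        unfolding lookup_z_eq[OF yz i k] sum_distrib_right[symmetric]
        by (subst sum_ennreal) (auto simp: y_nonneg)
    qed
    also have "\<dots> = emeasure (bary z) A"
      unfolding dirac_sum_def using A by (subst emeasure_distr_point_measure) auto
    finally show "emeasure (distr G borel fst) A = emeasure (bary z) A" .
  qed (simp add: dirac_sum_def)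
  moreover have "distr G borel snd = P i"
    unfolding discrete_prob_eq_dirac_sum[OF P]
  proof (rule measure_eqI)
    fix A :: "'a set" assume "A \<in> sets (distr G borel snd)"
    then have A: "A \<in> sets borel" by simp
    have "emeasure (distr G borel snd) A = (\<Sum>v\<in>V. f v * indicator A ((snd \<circ> \<tau>) v))"
      unfolding G_def using \<tau> A
      by (subst distr_distr, simp, simp) (intro emeasure_distr_point_measure, auto)
    also have "\<dots> = (\<Sum>j\<in>{1..N i}. \<Sum>k\<in>S i j. ennreal (Poly_Mapping.lookup y (i, j, k)) * indicator A (x i j))"
      unfolding sum_V by (simp add: f_def \<tau>_def)
    also have "\<dots> = (\<Sum>j\<in>{1..N i}. ennreal (d i j) * indicator A (x i j))"
    proof (intro sum.cong refl)
      fix j assume j: "j \<in> {1..N i}"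
      have "(\<Sum>k\<in>S i j. Poly_Mapping.lookup y (i, j, k)) = d i j"
        using yz i j unfolding feasible_iff by blast
      then show "(\<Sum>k\<in>S i j. ennreal (Poly_Mapping.lookup y (i, j, k)) * indicator A (x i j)) =
          ennreal (d i j) * indicator A (x i j)"
        unfolding sum_distrib_right[symmetric] by (subst sum_ennreal) (auto simp: y_nonneg)
    qed
    also have "\<dots> = emeasure (dirac_sum {1..N i} (d i) (x i)) A"
      unfolding dirac_sum_def using A by (subst emeasure_distr_point_measure) auto
    finally show "emeasure (distr G borel snd) A = emeasure (dirac_sum {1..N i} (d i) (x i)) A" .
  qed (simp add: dirac_sum_def)
  ultimately have "G \<in> couplings (bary z) (P i)"
    by (simp add: couplings_def G_def)
  then have "W2_squared (bary z) (P i) \<le> (\<integral>\<^sup>+ q. ennreal ((norm (fst q - snd q))\<^sup>2) \<partial>G)"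
    unfolding W2_squared_def by (rule INF_lower)
  also have "\<dots> = (\<Sum>v\<in>V. f v * ennreal ((norm (fst (\<tau> v) - snd (\<tau> v)))\<^sup>2))"
    unfolding G_def using \<tau> by (intro nn_integral_distr_point_measure) auto
  also have "\<dots> = ennreal (\<Sum>j\<in>{1..N i}. \<Sum>k\<in>S i j. (norm (X k - x i j))\<^sup>2 * Poly_Mapping.lookup y (i, j, k))"
    unfolding sum_V using y_nonneg
    by (simp add: f_def \<tau>_def mult.commute sum_nonneg flip: sum_ennreal ennreal_mult)
  finally show ?thesis .
qed

lemma objective_bary_le:
  assumes P: "\<And>i. i \<in> {1..n} \<Longrightarrow> discrete_prob (P i) (N i) (x i) (d i)" and yz: "(y, z) \<in> feasible"
  shows "barycenter_objective n lam P (bary z) \<le> ennreal (cost y)"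
proof -
  have "barycenter_objective n lam P (bary z) \<le> (\<Sum>i\<in>{1..n}. ennreal (lam i) *
      ennreal (\<Sum>j\<in>{1..N i}. \<Sum>k\<in>S i j. (norm (X k - x i j))\<^sup>2 * Poly_Mapping.lookup y (i, j, k)))"
    unfolding barycenter_objective_def
    by (intro sum_mono mult_left_mono W2_squared_bary_le[OF P _ yz]) auto
  also have "\<dots> = ennreal (cost y)"
    unfolding lp_cost_def using lookup_nonneg[OF yz] lam_nonneg
    by (subst sum_ennreal[symmetric]) (auto intro!: sum_nonneg mult_nonneg_nonneg sum.cong ennreal_mult[symmetric])
  finally show ?thesis .
qed

text \<open>The LP cost of \<open>y\<close> separates the two objectives: it bounds that of
  \<open>bary z\<close> from above and, by optimality against the points obtained from couplings,
  that of every \<open>Q\<close> from below.\<close>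

lemma optimal_is_barycenter:
  assumes P: "\<And>i. i \<in> {1..n} \<Longrightarrow> discrete_prob (P i) (N i) (x i) (d i)"
    and yz: "(y, z) \<in> lp_optimal n lam N x d X"
  shows "is_barycenter n lam P (bary z)"
  unfolding is_barycenter_def
proof (intro conjI ballI)
  have feas: "(y, z) \<in> feasible" and opt: "\<And>y' z'. (y', z') \<in> feasible \<Longrightarrow> cost y \<le> cost y'"
    using yz by (auto simp: lp_optimal_def)
  show "bary z \<in> prob2" by (rule bary_prob2[OF feas])
  fix Q :: "'a measure" assume Q: "Q \<in> prob2"
  have "barycenter_objective n lam P (bary z) \<le> ennreal (cost y)"
    by (rule objective_bary_le[OF P feas])
  also have "ennreal (cost y) \<le> barycenter_objective n lam P Q"
    unfolding barycenter_objective_def W2_squared_def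
  proof (rule le_sum_INF_ennreal)
    fix G assume G: "\<And>i. i \<in> {1..n} \<Longrightarrow> G i \<in> couplings Q (P i)"
    obtain y' z' where "(y', z') \<in> feasible"
      "ennreal (cost y') \<le> (\<Sum>i\<in>{1..n}. ennreal (lam i) * (\<integral>\<^sup>+ q. ennreal ((norm (fst q - snd q))\<^sup>2) \<partial>G i))"
      by (rule feasible_cost_le_couplings[OF P Q G])
    then show "ennreal (cost y) \<le> (\<Sum>i\<in>{1..n}. ennreal (lam i) * (\<integral>\<^sup>+ q. ennreal ((norm (fst q - snd q))\<^sup>2) \<partial>G i))"
      using opt ennreal_leI order_trans by blast
  qed (use lam_pos lam_sum in auto)
  finally show "barycenter_objective n lam P (bary z) \<le> barycenter_objective n lam P Q" .
qed

subsection \<open>Sparsity\<close>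

text \<open>With more positive \<open>z k\<close> than equations, some nonzero perturbation of the
  chosen entries preserves all sums, and a small multiple of it is feasible with either
  sign.\<close>

lemma extreme_point_card_support_le:
  assumes ext: "(y, z) extreme_point_of feasible"
  shows "card {k\<in>K. Poly_Mapping.lookup z k > 0} \<le> (\<Sum>i\<in>{1..n}. N i - 1) + 1"
proof (rule ccontr)
  define A where "A = {k\<in>K. Poly_Mapping.lookup z k > 0}"
  assume "\<not> ?thesis"
  then have many: "(\<Sum>i\<in>{1..n}. N i - 1) + 1 < card A"
    by (simp add: A_def)
  have yz: "(y, z) \<in> feasible"
    using ext by (simp add: extreme_point_of_def)
  have finA: "finite A" by (simp add: A_def)
  \<comment> \<open>For every measure, \<open>z k\<close> is a sum of nonnegative entries, so one of
    them is positive.\<close>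
  have "\<exists>j\<in>{1..N i}. k \<in> S i j \<and> Poly_Mapping.lookup y (i, j, k) > 0"
    if "k \<in> A" "i \<in> {1..n}" for i k
  proof (rule ccontr)
    assume "\<not> ?thesis"
    then have "Poly_Mapping.lookup y (i, j, k) = 0" if "j \<in> {1..N i}" "k \<in> S i j" for j
      using that lookup_nonneg[OF yz, of "(i, j, k)"] by force
    then have "Poly_Mapping.lookup z k = 0"
      using \<open>k \<in> A\<close> \<open>i \<in> {1..n}\<close> by (subst lookup_z_eq[OF yz, of i]) (auto simp: A_def)
    then show False using \<open>k \<in> A\<close> by (simp add: A_def)
  qed
  then obtain J where J: "\<And>i k. k \<in> A \<Longrightarrow> i \<in> {1..n} \<Longrightarrow>
      J k i \<in> {1..N i} \<and> k \<in> S i (J k i) \<and> Poly_Mapping.lookup y (i, J k i, k) > 0"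
    by metis
  \<comment> \<open>The pair \<open>(0, 0)\<close>, distinct from the others as their first entry is
    at least 1, stands for the vanishing of the total. For each \<open>i\<close> the equation of
    \<open>j = 1\<close> is left out, as it follows from the total and the others; hence
    \<open>N i - 1\<close> equations per measure plus one.\<close>
  define E where "E = insert (0, 0) (SIGMA i:{1..n}. {2..N i})"
  define a :: "nat \<times> nat \<Rightarrow> nat \<Rightarrow> real" where
    "a = (\<lambda>(i, j) k. if i = 0 then 1 else of_bool (J k i = j))"
  have "card E = (\<Sum>i\<in>{1..n}. N i - 1) + 1"
    unfolding E_def by (subst card_insert_disjoint) (auto intro!: finite_SigmaI)
  with many have "card E < card A" by simp
  moreover have "finite E"
    by (auto simp: E_def)
  ultimately obtain t where t: "\<exists>k\<in>A. t k \<noteq> 0" "\<And>e. e \<in> E \<Longrightarrow> (\<Sum>k\<in>A. t k * a e k) = 0"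
    using homogeneous_system_nontrivial_solution[of E A a] finA by blast
  have t_sum: "(\<Sum>k\<in>A. t k) = 0"
    using t(2)[of "(0, 0)"] by (simp add: E_def a_def)
  have t_ge2: "(\<Sum>k\<in>A. t k * of_bool (J k i = j)) = 0" if "i \<in> {1..n}" "j \<in> {2..N i}" for i j
    using t(2)[of "(i, j)"] that unfolding E_def a_def by (simp del: sum_mult_of_bool_eq)
  have t_ij: "(\<Sum>k\<in>A. t k * of_bool (J k i = j)) = 0" if i: "i \<in> {1..n}" and j: "j \<in> {1..N i}" for i j
  proof (cases "j = 1")
    case True
    \<comment> \<open>The omitted equation: each \<open>k\<close> has exactly one chosen
      \<open>j\<close>, so the sums over all \<open>j\<close> add up to the total 0, and those with
      \<open>j\<close> at least 2 vanish.\<close>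
    have "0 = (\<Sum>k\<in>A. \<Sum>j\<in>{1..N i}. t k * of_bool (J k i = j))"
      unfolding t_sum[symmetric]
    proof (intro sum.cong refl)
      fix k assume "k \<in> A"
      then show "t k = (\<Sum>j\<in>{1..N i}. t k * of_bool (J k i = j))"
        using J[of k i] i by (subst sum_mult_of_bool[where f = "\<lambda>_. t k"]) auto
    qed
    also have "\<dots> = (\<Sum>j\<in>{1..N i}. \<Sum>k\<in>A. t k * of_bool (J k i = j))"
      by (rule sum.swap)
    also have "{1..N i} = insert 1 {2..N i}"
      using j by auto
    also have "(\<Sum>j\<in>insert 1 {2..N i}. \<Sum>k\<in>A. t k * of_bool (J k i = j)) =
        (\<Sum>k\<in>A. t k * of_bool (J k i = j))"
      using t_ge2[OF i] True by (subst sum.insert) (auto simp del: sum_mult_of_bool_eq intro!: sum.neutral)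
    finally show ?thesis by simp
  next
    case False
    then show ?thesis using t_ge2 i j by (simp del: sum_mult_of_bool_eq)
  qed
  \<comment> \<open>The direction of the perturbation: \<open>t k\<close> is added at the one chosen
    entry of each measure and at \<open>z k\<close>.\<close>
  define hy where "hy = (\<lambda>(i, j, k). t k * of_bool (k \<in> A \<and> J k i = j))"
  obtain Hy where Hy: "\<And>v. Poly_Mapping.lookup Hy v = (if v \<in> lp_vars then hy v else 0)"
    using exists_poly_mapping[OF finite_lp_vars, of hy] by blast
  obtain Hz where Hz: "\<And>k. Poly_Mapping.lookup Hz k = (if k \<in> A then t k else 0)"
    using exists_poly_mapping[OF finA, of t] by blast
  \<comment> \<open>Adding 1 to the denominator avoids division by zero when \<open>t k\<close>
    vanishes; the inserted 1 below makes the set in the minimum visibly nonempty.\<close>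
  define q where "q = (\<lambda>(i, k). Poly_Mapping.lookup y (i, J k i, k) / (\<bar>t k\<bar> + 1))"
  define \<epsilon> where "\<epsilon> = Min (insert 1 (q ` ({1..n} \<times> A)))"
  have \<epsilon>_pos: "\<epsilon> > 0"
    unfolding \<epsilon>_def using J finA
    by (subst Min_gr_iff) (auto simp: q_def intro!: divide_pos_pos)
  have \<epsilon>_le: "\<epsilon> * \<bar>t k\<bar> \<le> Poly_Mapping.lookup y (i, J k i, k)" if "i \<in> {1..n}" "k \<in> A" for i k
  proof -
    have "\<epsilon> \<le> q (i, k)"
      unfolding \<epsilon>_def using that finA by (intro Min_le) auto
    then have "\<epsilon> * (\<bar>t k\<bar> + 1) \<le> Poly_Mapping.lookup y (i, J k i, k)"
      by (simp add: q_def pos_le_divide_eq)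
    with \<epsilon>_pos show ?thesis by (simp add: algebra_simps)
  qed
  have perturbed: "(y + s *\<^sub>R Hy, z + s *\<^sub>R Hz) \<in> feasible" if s: "\<bar>s\<bar> = \<epsilon>" for s
  proof -
    \<comment> \<open>Only chosen entries change, and these are at least \<open>\<epsilon>\<close>
      times the absolute value of \<open>t k\<close>.\<close>
    have "Poly_Mapping.lookup y v + s * Poly_Mapping.lookup Hy v \<ge> 0" for v
    proof (cases "v \<in> lp_vars \<and> hy v \<noteq> 0")
      case True
      then obtain i k where v: "v = (i, J k i, k)" "i \<in> {1..n}" "k \<in> A" "Poly_Mapping.lookup Hy v = t k"
        by (cases v) (auto simp: Hy hy_def lp_vars_def)
      have "\<bar>s * t k\<bar> \<le> Poly_Mapping.lookup y v"
        using \<epsilon>_le[OF v(2,3)] s v(1) by (simp add: abs_mult)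
      then show ?thesis using v(4) by auto
    next
      case False
      then show ?thesis using lookup_nonneg[OF yz, of v] by (auto simp: Hy)
    qed
    moreover have "(\<Sum>j\<in>{j\<in>{1..N i}. k \<in> S i j}. Poly_Mapping.lookup Hy (i, j, k)) = Poly_Mapping.lookup Hz k"
      if "i \<in> {1..n}" "k \<in> K" for i k
    proof -
      have "(\<Sum>j\<in>{j\<in>{1..N i}. k \<in> S i j}. Poly_Mapping.lookup Hy (i, j, k)) =
          (\<Sum>j\<in>{j\<in>{1..N i}. k \<in> S i j}. (if k \<in> A then t k else 0) * of_bool (J k i = j))"
        using that by (intro sum.cong) (auto simp: Hy hy_def lp_vars_def)
      also have "\<dots> = (if k \<in> A then t k else 0)"
      proof (cases "k \<in> A")
        case True
        then show ?thesis using J[OF True that(1)] by (subst sum_mult_of_bool[where f = "\<lambda>_. _"]) auto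
      qed simp
      finally show ?thesis by (simp add: Hz)
    qed
    moreover have "(\<Sum>k\<in>S i j. Poly_Mapping.lookup Hy (i, j, k)) = 0"
      if "i \<in> {1..n}" "j \<in> {1..N i}" for i j
    proof -
      have "(\<Sum>k\<in>S i j. Poly_Mapping.lookup Hy (i, j, k)) = (\<Sum>k\<in>S i j \<inter> A. t k * of_bool (J k i = j))"
        using that by (intro sum.mono_neutral_cong_right) (auto simp: Hy hy_def lp_vars_def)
      \<comment> \<open>No term is lost outside \<open>S i j\<close>, because \<open>k\<close>
        always lies in \<open>S i (J k i)\<close>.\<close>
      also have "\<dots> = (\<Sum>k\<in>A. t k * of_bool (J k i = j))"
        using that J finA by (intro sum.mono_neutral_left) auto
      finally show ?thesis using t_ij[OF that] by simp
    qed
    moreover have "Poly_Mapping.keys (y + s *\<^sub>R Hy) \<subseteq> lp_vars"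
      using lookup_outside_vars[OF yz]
      by (auto simp: in_keys_iff lookup_add lookup_scaleR_poly_mapping Hy split: if_splits)
    moreover have "Poly_Mapping.keys (z + s *\<^sub>R Hz) \<subseteq> K"
      using yz by (auto simp: feasible_iff in_keys_iff lookup_add lookup_scaleR_poly_mapping Hz A_def subset_iff split: if_splits)
    ultimately show ?thesis
      using yz unfolding feasible_iff
      by (simp add: lookup_add lookup_scaleR_poly_mapping sum.distrib flip: sum_distrib_left)
  qed
  have "(\<epsilon> *\<^sub>R Hy, \<epsilon> *\<^sub>R Hz) \<noteq> 0"
  proof
    assume "(\<epsilon> *\<^sub>R Hy, \<epsilon> *\<^sub>R Hz) = 0"
    then have "Hz = 0"
      using \<epsilon>_pos by (simp add: zero_prod_def)
    then show False
      using t(1) Hz by (metis lookup_zero)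
  qed
  from pair_in_open_segment[OF this, of "(y, z)"]
  have "(y, z) \<in> open_segment (y - \<epsilon> *\<^sub>R Hy, z - \<epsilon> *\<^sub>R Hz) (y + \<epsilon> *\<^sub>R Hy, z + \<epsilon> *\<^sub>R Hz)"
    by simp
  moreover have "(y - \<epsilon> *\<^sub>R Hy, z - \<epsilon> *\<^sub>R Hz) \<in> feasible" "(y + \<epsilon> *\<^sub>R Hy, z + \<epsilon> *\<^sub>R Hz) \<in> feasible"
    using perturbed[of "- \<epsilon>"] perturbed[of \<epsilon>] \<epsilon>_pos by auto
  ultimately show False
    using ext by (auto simp: extreme_point_of_def)
qed

text \<open>The complement of the finitely many atoms with positive weight is an open null set, so
  it contains no support point.\<close>

lemma supp_bary_subset:
  assumes "(y, z) \<in> feasible"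
  shows "supp (bary z) \<subseteq> X ` {k\<in>K. Poly_Mapping.lookup z k > 0}"
proof
  fix p assume p: "p \<in> supp (bary z)"
  define U where "U = - (X ` {k\<in>K. Poly_Mapping.lookup z k > 0})"
  have "open U"
    unfolding U_def by (intro open_Compl finite_imp_closed) auto
  moreover have "emeasure (bary z) U = (\<Sum>k\<in>K. ennreal (Poly_Mapping.lookup z k) * indicator U (X k))"
    unfolding dirac_sum_def using \<open>open U\<close> by (intro emeasure_distr_point_measure) auto
  moreover have "\<dots> = 0"
    using lookup_z_nonneg[OF assms]
    by (intro sum.neutral) (auto simp: U_def ennreal_eq_0_iff not_less split: split_indicator)
  ultimately have "p \<notin> U"
    using p by (auto simp: supp_def)
  then show "p \<in> X ` {k\<in>K. Poly_Mapping.lookup z k > 0}"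
    by (simp add: U_def)
qed

lemma extreme_point_is_sparse:
  assumes P: "\<And>i. i \<in> {1..n} \<Longrightarrow> discrete_prob (P i) (N i) (x i) (d i)"
    and yz: "(y, z) \<in> lp_optimal n lam N x d X"
    and ext: "(y, z) extreme_point_of feasible"
  shows "is_sparse_barycenter n lam P (bary z)"
  unfolding is_sparse_barycenter_def
proof (intro conjI)
  define A where "A = {k\<in>K. Poly_Mapping.lookup z k > 0}"
  have A: "finite A" by (simp add: A_def)
  have feas: "(y, z) \<in> feasible" using yz by (simp add: lp_optimal_def)
  have supp: "supp (bary z) \<subseteq> X ` A"
    unfolding A_def by (rule supp_bary_subset[OF feas])
  show "is_barycenter n lam P (bary z)"
    by (rule optimal_is_barycenter[OF P yz])
  show "finite (supp (bary z))"
    using supp A finite_surj by blast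
  have "card (supp (bary z)) \<le> card A"
    using supp A surj_card_le by blast
  also have "\<dots> \<le> (\<Sum>i\<in>{1..n}. N i - 1) + 1"
    unfolding A_def by (rule extreme_point_card_support_le[OF ext])
  finally have "int (card (supp (bary z))) \<le> (\<Sum>i\<in>{1..n}. int (N i - 1)) + 1"
    by (metis (mono_tags, lifting) of_nat_1 of_nat_add of_nat_mono of_nat_sum sum.cong)
  \<comment> \<open>Each \<open>N i\<close> is positive because the masses sum to 1, so the
    truncated subtraction agrees with the one over the integers.\<close>
  also have "(\<Sum>i\<in>{1..n}. int (N i - 1)) = (\<Sum>i\<in>{1..n}. int (card (supp (P i))) - 1)"
  proof (intro sum.cong refl)
    fix i assume i: "i \<in> {1..n}"
    have "card (supp (P i)) = N i"
      using P[OF i] bij_betw_same_card[of "x i" "{1..N i}"] by (simp add: discrete_prob_def)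
    moreover have "N i \<noteq> 0"
      using d_sum[OF i] by (intro notI) simp
    ultimately show "int (N i - 1) = int (card (supp (P i))) - 1" by simp
  qed
  finally show "int (card (supp (bary z))) \<le> (\<Sum>i\<in>{1..n}. int (card (supp (P i)))) - int n + 1"
    by (simp add: sum_subtractf)
qed

end

theorem theorem1:
  fixes n :: nat
    and P :: "nat \<Rightarrow> (real ^ 'd) measure"
    and lam :: "nat \<Rightarrow> real"
    and N :: "nat \<Rightarrow> nat"
    and x :: "nat \<Rightarrow> nat \<Rightarrow> real ^ 'd"
    and d :: "nat \<Rightarrow> nat \<Rightarrow> real"
    and X :: "nat \<Rightarrow> real ^ 'd"
  assumes "\<forall>i\<in>{1..n}. discrete_prob (P i) (N i) (x i) (d i)"
    and "\<forall>i\<in>{1..n}. lam i > 0"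
    and "(\<Sum>i\<in>{1..n}. lam i) = 1"
    and "bij_betw X {1..card (weighted_means n lam N x)} (weighted_means n lam N x)"
  shows "lp_optimal n lam N x d X \<noteq> {} \<and>
    (\<forall>(y, z) \<in> lp_optimal n lam N x d X.
       is_barycenter n lam P
         (dirac_sum {1..card (weighted_means n lam N x)} (Poly_Mapping.lookup z) X)) \<and>
    (\<forall>(y, z) \<in> lp_optimal n lam N x d X.
       (y, z) extreme_point_of lp_feasible n lam N x d X \<longrightarrow>
       is_sparse_barycenter n lam P
         (dirac_sum {1..card (weighted_means n lam N x)} (Poly_Mapping.lookup z) X))"
proof -
  interpret barycenter_lp n lam N x d X
    using assms by unfold_locales (auto simp: discrete_prob_def)
  show ?thesis
    using optimal_nonempty optimal_is_barycenter[of P] extreme_point_is_sparse[of P] assms(1)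
    by blast
qed

end
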